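(* Let $q$ be a prime power, let $V$ be an $n$-dimensional vector space over $\mathbb{F}_q$, and let $t \geq 1$, $r \geq 2$, $k \geq r+t-1$ and $n \geq 3kr^2 + 3krt$ be integers. Let $\mathcal{F} \subseteq {V \brack k}$ be an $r$-wise $t$-intersecting family. Then $$\mathcal{N}(\Delta_{r+1,t}, \mathcal{F}) \leq n_{t+r,k},$$ with equality holding if and only if $\mathcal{F}^*_{X,k} \subseteq \mathcal{F} \subseteq \mathcal{F}_{X,k}$ for some $(r+t)$-dimensional subspace $X$ of $V$.
   Context: ${V\brack k}$ denotes the set of all $k$-dimensional subspaces of $V$. A family $\mathcal{F}$ of subspaces is $r$-wise $t$-intersecting if $\dim(F_1\cap\cdots\cap F_r)\ge t$ for any $F_1,\dots,F_r\in\mathcal{F}$. An $(r+1,t)$-simplex, denoted $\Delta_{r+1,t}$, is an $r$-wise $t$-intersecting family $\{F_1,\dots,F_{r+1}\}$ of $r+1$ (distinct) subspaces with $\dim(\bigcap_{i=1}^{r+1}F_i)<t$. $\mathcal{N}(\Delta_{r+1,t},\mathcal{F})$ is the number of $(r+1)$-element subsets of $\mathcal{F}$ that form an $(r+1,t)$-simplex. For a subspace $X$ of $V$, $\mathcal{F}_{X,k}=\{F\in{V\brack k}:\dim(F\cap X)\ge\dim(X)-1\}$ and $\mathcal{F}^*_{X,k}=\{F\in{V\brack k}:\dim(F\cap X)=\dim(X)-1\}$. Finally $n_{t+r,k}=\mathcal{N}(\Delta_{r+1,t},\mathcal{F}_{X,k})$, where $X$ is any $(t+r)$-dimensional subspace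 of $V$ (the value does not depend on the choice of $X$). *)

theory Defs
  imports Main HOL.Vector_Spaces
begin

context vector_space
begin

definition k_subspaces :: "nat \<Rightarrow> 'b set set" where
  "k_subspaces k = {F. subspace F \<and> dim F = k}"

text \<open>The \<open>F\<^sub>i\<close> need not be distinct.\<close>

definition wise_intersecting :: "nat \<Rightarrow> nat \<Rightarrow> 'b set set \<Rightarrow> bool" where
  "wise_intersecting r t \<F> \<longleftrightarrow>
     (\<forall>F :: nat \<Rightarrow> 'b set. (\<forall>i\<in>{1..r}. F i \<in> \<F>) \<longrightarrow> t \<le> dim (\<Inter>i\<in>{1..r}. F i))"

text \<open>\<open>is_simplex r t S\<close>: the family \<open>S\<close> is an \<open>(r+1, t)\<close>-simplex.\<close>

definition is_simplex :: "nat \<Rightarrow> nat \<Rightarrow> 'b set set \<Rightarrow> bool" where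
  "is_simplex r t S \<longleftrightarrow>
     (\<forall>F\<in>S. subspace F) \<and> card S = r + 1 \<and> wise_intersecting r t S \<and> dim (\<Inter>S) < t"

definition num_simplices :: "nat \<Rightarrow> nat \<Rightarrow> 'b set set \<Rightarrow> nat" where
  "num_simplices r t \<F> = card {S. S \<subseteq> \<F> \<and> is_simplex r t S}"

text \<open>In the next two definitions the \<open>1\<close> is moved to the other side because subtraction on
  \<^typ>\<open>nat\<close> truncates.\<close>

definition near_subspaces :: "'b set \<Rightarrow> nat \<Rightarrow> 'b set set" where
  "near_subspaces X k = {F \<in> k_subspaces k. dim (F \<inter> X) + 1 \<ge> dim X}"

definition near_subspaces_star :: "'b set \<Rightarrow> nat \<Rightarrow> 'b set set" where
  "near_subspaces_star X k = {F \<in> k_subspaces k. dim (F \<inter> X) + 1 = dim X}"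

text \<open>The number \<open>n\<^bsub>t+r,k\<^esub>\<close>. It depends on \<open>r\<close> and \<open>t\<close> separately, since they are
  parameters of the simplices being counted. It does not depend on the choice of \<open>X\<close>: see
  \<open>extremal_number_eq\<close> below.\<close>

definition extremal_number :: "nat \<Rightarrow> nat \<Rightarrow> nat \<Rightarrow> nat" where
  "extremal_number r t k =
     num_simplices r t (near_subspaces (SOME X. X \<in> k_subspaces (t + r)) k)"

end

context finite_dimensional_vector_space
begin

lemma linear_bij_subspace:
  assumes X: "subspace X" and Y: "subspace Y" and d: "dim X = dim Y"
  shows "\<exists>g. Vector_Spaces.linear scale scale g \<and> bij g \<and> g ` X = Y"
proof -
  interpret P: finite_dimensional_vector_space_pair scale Basis scale Basis
    by unfold_locales
  obtain B where B: "B \<subseteq> X" "independent B" "X \<subseteq> span B" "card B = dim X"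
    using basis_exists by blast
  obtain C where C: "C \<subseteq> Y" "independent C" "Y \<subseteq> span C" "card C = dim Y"
    using basis_exists by blast
  have sB: "span B = X" and sC: "span C = Y"
    using span_subspace[OF B(1,3) X] span_subspace[OF C(1,3) Y] by simp_all
  define B' where "B' = extend_basis B"
  define C' where "C' = extend_basis C"
  have B': "B \<subseteq> B'" "independent B'" "span B' = UNIV"
    unfolding B'_def using B(2) extend_basis_superset independent_extend_basis by auto
  have C': "C \<subseteq> C'" "independent C'" "span C' = UNIV"
    unfolding C'_def using C(2) extend_basis_superset independent_extend_basis by auto
  have fin: "finite B'" "finite C'"
    using B'(2) C'(2) finiteI_independent by auto
  have "card B' = card C'"
    using dim_span_eq_card_independent[OF B'(2)] dim_span_eq_card_independent[OF C'(2)] B'(3) C'(3)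
    by simp
  moreover have "finite B" "finite C"
    using B'(1) C'(1) fin finite_subset by auto
  ultimately have "card (B' - B) = card (C' - C)"
    using B(4) C(4) d B'(1) C'(1) by (simp add: card_Diff_subset)
  then obtain h2 where h2: "bij_betw h2 (B' - B) (C' - C)"
    using fin finite_same_card_bij by blast
  obtain h1 where h1: "bij_betw h1 B C"
    using finite_same_card_bij[OF \<open>finite B\<close> \<open>finite C\<close>] B(4) C(4) d by auto
  define h where "h x = (if x \<in> B then h1 x else h2 x)" for x
  have hB: "bij_betw h B C"
    using h1 by (rule bij_betw_cong[THEN iffD1, rotated]) (simp add: h_def)
  have hR: "bij_betw h (B' - B) (C' - C)"
    using h2 by (rule bij_betw_cong[THEN iffD1, rotated]) (simp add: h_def)
  have hB': "bij_betw h B' C'"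
    using bij_betw_combine[OF hB hR] B'(1) C'(1) by (auto simp: Un_absorb1)
  define g where "g = P.construct B' h"
  have lin: "Vector_Spaces.linear scale scale g"
    unfolding g_def by (rule P.linear_construct[OF B'(2)])
  have gh: "g b = h b" if "b \<in> B'" for b
    unfolding g_def by (rule P.construct_basis[OF B'(2) that])
  have img: "g ` B' = C'"
    using hB' gh by (auto simp: bij_betw_def)
  have inj: "inj_on g B'"
    using hB' gh by (auto simp: bij_betw_def inj_on_def)
  have "inj_on g (span B')"
    using P.linear_inj_on_span_independent_image[OF lin _ inj] img C'(2) by simp
  moreover have "range g = UNIV"
    using P.linear_span_image[OF lin, of B'] B'(3) C'(3) img by simp
  ultimately have "bij g"
    using B'(3) by (simp add: bij_def)
  moreover have "g ` B = h ` B"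
    by (rule image_cong[OF refl], rule gh) (rule subsetD[OF B'(1)])
  then have "g ` B = C"
    using hB by (simp add: bij_betw_def)
  then have "g ` X = Y"
    using P.linear_span_image[OF lin, of B] sB sC by simp
  ultimately show ?thesis
    using lin by (intro exI[of _ g] conjI)
qed

lemma num_simplices_near_subspaces_le:
  assumes X: "subspace X" and Y: "subspace Y" and d: "dim X = dim Y"
  shows "\<exists>G. inj_on G {S. S \<subseteq> near_subspaces X k \<and> is_simplex r t S} \<and>
    G ` {S. S \<subseteq> near_subspaces X k \<and> is_simplex r t S} \<subseteq> {S. S \<subseteq> near_subspaces Y k \<and> is_simplex r t S}"
proof -
  interpret P: finite_dimensional_vector_space_pair scale Basis scale Basis
    by unfold_locales
  obtain g where lin: "Vector_Spaces.linear scale scale g" and bij: "bij g" and gX: "g ` X = Y"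
    using linear_bij_subspace[OF assms] by (elim exE conjE)
  have inj: "inj g" using bij by (simp add: bij_def)
  have dimg: "dim (g ` A) = dim A" for A
    by (rule P.dim_image_eq[OF lin inj_on_subset[OF inj subset_UNIV]])
  have subg: "subspace (g ` A)" if "subspace A" for A
    using P.linear_subspace_image[OF lin that] .
  define G where "G = (\<lambda>S. (\<lambda>A. g ` A) ` S)"
  have inj_im: "inj ((`) g)"
    by (rule injI) (simp add: inj_image_eq_iff[OF inj])
  have injG: "inj G"
    unfolding G_def by (rule injI) (simp add: inj_image_eq_iff[OF inj_im])
  have near: "g ` F \<in> near_subspaces Y k" if "F \<in> near_subspaces X k" for F
    using that unfolding near_subspaces_def k_subspaces_def gX[symmetric]
    by (simp add: image_Int[OF inj, symmetric] dimg subg)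
  have simplex: "is_simplex r t (G S)" if S: "is_simplex r t S" for S
  proof -
    have cS: "card (G S) = card S"
      unfolding G_def by (rule card_image) (rule inj_on_subset[OF inj_im subset_UNIV])
    have "S \<noteq> {}" using S by (auto simp: is_simplex_def)
    then have "\<Inter>(G S) = g ` (\<Inter>S)"
      unfolding G_def using bij_image_INT[OF bij, of "\<lambda>A. A" S] by simp
    moreover have "wise_intersecting r t (G S)"
      unfolding wise_intersecting_def
    proof (intro allI impI)
      fix F assume F: "\<forall>i\<in>{1..r}. F i \<in> G S"
      then have "\<forall>i\<in>{1..r}. \<exists>A. A \<in> S \<and> F i = g ` A"
        unfolding G_def by blast
      from bchoice[OF this] obtain H
        where H: "\<And>i. i \<in> {1..r} \<Longrightarrow> H i \<in> S \<and> F i = g ` H i" by blast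
      have "(\<Inter>i\<in>{1..r}. F i) = g ` (\<Inter>i\<in>{1..r}. H i)"
      proof -
        have "(\<Inter>i\<in>{1..r}. F i) = (\<Inter>i\<in>{1..r}. g ` H i)"
          using H by (intro INF_cong) auto
        also have "\<dots> = g ` (\<Inter>i\<in>{1..r}. H i)"
          by (rule bij_image_INT[OF bij, symmetric])
        finally show ?thesis .
      qed
      moreover have "t \<le> dim (\<Inter>i\<in>{1..r}. H i)"
        using S H unfolding is_simplex_def wise_intersecting_def by (elim conjE allE[of _ H]) simp
      ultimately show "t \<le> dim (\<Inter>i\<in>{1..r}. F i)"
        by (simp add: dimg)
    qed
    ultimately show ?thesis
      using S cS subg unfolding is_simplex_def by (auto simp: dimg G_def)
  qed
  have "G ` {S. S \<subseteq> near_subspaces X k \<and> is_simplex r t S}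
      \<subseteq> {S. S \<subseteq> near_subspaces Y k \<and> is_simplex r t S}"
  proof clarify
    fix S assume "S \<subseteq> near_subspaces X k" "is_simplex r t S"
    then show "G S \<subseteq> near_subspaces Y k \<and> is_simplex r t (G S)"
      using near simplex[of S] unfolding G_def by blast
  qed
  then show ?thesis
    by (intro exI[of _ G] conjI inj_on_subset[OF injG subset_UNIV])
qed

lemma num_simplices_near_subspaces_eq:
  assumes X: "subspace X" and Y: "subspace Y" and d: "dim X = dim Y"
  shows "num_simplices r t (near_subspaces X k) = num_simplices r t (near_subspaces Y k)"
proof -
  let ?A = "\<lambda>X. {S. S \<subseteq> near_subspaces X k \<and> is_simplex r t S}"
  obtain G where G: "inj_on G (?A X)" "G ` ?A X \<subseteq> ?A Y"
    using num_simplices_near_subspaces_le[OF X Y d, of k r t] by blast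
  obtain H where H: "inj_on H (?A Y)" "H ` ?A Y \<subseteq> ?A X"
    using num_simplices_near_subspaces_le[OF Y X d[symmetric], of k r t] by blast
  obtain h where "bij_betw h (?A X) (?A Y)"
    using Schroeder_Bernstein[OF G H] by blast
  then show ?thesis
    unfolding num_simplices_def by (rule bij_betw_same_card)
qed

theorem extremal_number_eq:
  assumes "X \<in> k_subspaces (t + r)"
  shows "extremal_number r t k = num_simplices r t (near_subspaces X k)"
proof -
  have "(SOME X. X \<in> k_subspaces (t + r)) \<in> k_subspaces (t + r)"
    using assms by (rule someI)
  then show ?thesis
    using assms unfolding extremal_number_def
    by (intro num_simplices_near_subspaces_eq) (auto simp: k_subspaces_def)
qed

end

end

theory Submission
  imports Defs "HOL.Binomial" "HOL-Library.FuncSet"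
begin

text \<open>
  Put \<open>m = r + t - 2\<close>, so that an \<open>(r+t)\<close>-space \<open>X\<close> has dimension \<open>m + 2\<close>, and let \<open>c\<close> and \<open>d\<close> be
  the numbers of \<open>k\<close>-spaces containing a given subspace of dimension \<open>m + 1\<close> and \<open>m + 2\<close>. Since
  \<open>q\<^bsup>n-k\<^esup> d \<le> c\<close> and \<open>n\<close> is large, one factor \<open>c\<close> replaced by \<open>d\<close> outweighs every other factor
  in a count, and crude bounds on those factors suffice.

  Suppose that \<open>\<F>\<close> contains a simplex. Then its total intersection has dimension below \<open>t\<close>, so an
  intersection of few members can be cut down by one dimension for each further member; with
  \<open>r\<close>-wise \<open>t\<close>-intersection this gives \<open>dim (F \<inter> G) \<ge> m\<close> for all members \<open>F\<close>, \<open>G\<close>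
  (\<open>wise_intersecting_pairwise\<close>). Fix \<open>F\<^sub>1 \<in> \<F>\<close>. Each member \<open>F\<close> contains an \<open>m\<close>-space \<open>E \<subseteq> F\<^sub>1\<close>, and
  some member does not contain \<open>E\<close>, which forces one of its vectors outside \<open>E\<close> into \<open>F\<close>: so \<open>F\<close> contains an
  \<open>(m+1)\<close>-dimensional kernel from a list of at most \<open>K = q\<^bsup>km+k\<^esup>\<close> subspaces (\<open>kernels_exist\<close>).
  Attach such a kernel to each member.

  Call a set of members generic if the kernels of its elements meet all members of \<open>\<F>\<close> in dimension at
  least \<open>m\<close> and two distinct elements meet only inside their kernels. If a set is not generic, then one
  of its elements contains a vector, outside its own kernel, of a member that is another element or is
  determined by the kernel. For each choice of this member there are
  at most \<open>K q\<^sup>k d\<close> such elements, whence at most \<open>2 K q\<^sup>k d (K c)\<^sup>r\<close> nongeneric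
  sets of \<open>r + 1\<close> members (\<open>card_nongeneric_le\<close>). On the other hand, choosing \<open>r + 1\<close> hyperplanes of \<open>X\<close>
  in general position and extending each of them to a \<open>k\<close>-space in a generic way yields at least
  \<open>(c/2)\<^bsup>r+1\<^esup>\<close> simplices in the extremal family (\<open>simplices_near_lower_bound\<close>). So if all simplices of
  \<open>\<F>\<close> are nongeneric, their number is strictly below the extremal one.

  In a generic simplex the kernels pairwise meet in dimension at least \<open>m\<close> but have a smaller total
  intersection; hence three of them lie as hyperplanes without a common \<open>m\<close>-space in one
  \<open>(m+2)\<close>-space \<open>X\<close>. A subspace meeting all three in dimension at least \<open>m\<close> meets \<open>X\<close> in dimension at
  least \<open>m + 1\<close> (\<open>three_kernels\<close>), so all of \<open>\<F>\<close> lies in the extremal family of \<open>X\<close>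
  (\<open>generic_simplex_near\<close>) and the inequality is monotonicity.

  The case of equality follows because the simplices of the extremal family use exactly the members
  that meet \<open>X\<close> in a hyperplane: a member containing \<open>X\<close> lies in no simplex (\<open>simplex_near_star\<close>),
  and every other member lies in one (second part of \<open>simplices_near_lower_bound\<close>).
\<close>

section \<open>Intersections of subspaces\<close>

context finite_dimensional_vector_space
begin

lemma dim_span_Un:
  assumes "subspace U" "subspace W"
  shows "dim (span (U \<union> W)) + dim (U \<inter> W) = dim U + dim W"
  using dim_sums_Int[OF assms] assms by (simp add: span_Un span_eq_iff[THEN iffD2])

lemma dim_Int_in_subspace:
  assumes "subspace U" "subspace W" "subspace X" "U \<subseteq> X" "W \<subseteq> X"
  shows "dim U + dim W \<le> dim X + dim (U \<inter> W)"
proof -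
  have "dim (span (U \<union> W)) \<le> dim X"
    using assms by (intro dim_subset span_minimal) auto
  then show ?thesis using dim_span_Un[OF assms(1,2)] by linarith
qed

text \<open>Intersecting with a subspace that contains a hyperplane of \<open>X\<close> costs at most one
  dimension inside \<open>X\<close>.\<close>

lemma dim_Inter_near:
  assumes "finite A" "subspace X"
    and "\<And>F. F \<in> A \<Longrightarrow> subspace F \<and> dim X \<le> dim (F \<inter> X) + 1"
  shows "dim X \<le> dim (X \<inter> \<Inter>A) + card A"
  using assms(1,3)
proof (induction A rule: finite_induct)
  case empty
  then show ?case by simp
next
  case (insert F A)
  have IH: "dim X \<le> dim (X \<inter> \<Inter>A) + card A" using insert by simp
  have F: "subspace F" "dim X \<le> dim (F \<inter> X) + 1" using insert.prems by auto
  have A: "subspace (\<Inter>A)" using insert.prems by (intro subspace_Inter) auto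
  have "dim (X \<inter> \<Inter>A) + dim (F \<inter> X) \<le> dim X + dim ((X \<inter> \<Inter>A) \<inter> (F \<inter> X))"
    using A F(1) assms(2) by (intro dim_Int_in_subspace subspace_inter) auto
  also have "(X \<inter> \<Inter>A) \<inter> (F \<inter> X) = X \<inter> \<Inter>(insert F A)" by auto
  finally show ?case using IH F(2) insert.hyps by simp
qed

text \<open>As long as the current intersection has dimension at least \<open>t\<close>, it is not contained in
  \<open>\<Inter>\<F>\<close>, so some member of \<open>\<F>\<close> lowers its dimension. Applied to members of an intersecting family
  this bounds dimensions of intersections of few members from below; applied to the hyperplanes of a
  space it produces hyperplanes in general position.\<close>

lemma exists_subfamily_cutting_down:
  assumes sub: "\<And>F. F \<in> \<F> \<Longrightarrow> subspace F" and small: "dim (\<Inter>\<F>) < t" and W: "subspace W"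
  shows "\<exists>A\<subseteq>\<F>. finite A \<and> card A \<le> j \<and> dim (W \<inter> \<Inter>A) \<le> max (t - 1) (dim W - j)"
proof (induction j)
  case 0
  show ?case by (intro exI[of _ "{}"]) auto
next
  case (Suc j)
  then obtain A where A: "A \<subseteq> \<F>" "finite A" "card A \<le> j"
    "dim (W \<inter> \<Inter>A) \<le> max (t - 1) (dim W - j)" by blast
  have sA: "subspace (W \<inter> \<Inter>A)"
    using A(1) sub W by (intro subspace_inter subspace_Inter) auto
  show ?case
  proof (cases "dim (W \<inter> \<Inter>A) < t")
    case True
    then show ?thesis using A by (intro exI[of _ A]) auto
  next
    case False
    then have "\<not> W \<inter> \<Inter>A \<subseteq> \<Inter>\<F>"
      using small dim_subset by (meson le_less_trans)
    then obtain F where F: "F \<in> \<F>" "\<not> W \<inter> \<Inter>A \<subseteq> F" by blast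
    have eq: "W \<inter> \<Inter>(insert F A) = (W \<inter> \<Inter>A) \<inter> F" by auto
    have s: "subspace ((W \<inter> \<Inter>A) \<inter> F)" using sA sub[OF F(1)] by (rule subspace_inter)
    have "dim ((W \<inter> \<Inter>A) \<inter> F) < dim (W \<inter> \<Inter>A)"
      using F(2) sA s by (intro dim_psubset) (auto simp: span_eq_iff[THEN iffD2])
    then have "dim (W \<inter> \<Inter>(insert F A)) \<le> max (t - 1) (dim W - Suc j)"
      unfolding eq using A(4) False by linarith
    moreover have "card (insert F A) \<le> Suc j" using A(2,3) by (simp add: card_insert_if)
    ultimately show ?thesis using A F(1) by (intro exI[of _ "insert F A"]) auto
  qed
qed

lemma hyperplane_avoiding:
  assumes X: "subspace X" and w: "w \<in> X" "w \<noteq> 0"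
  shows "\<exists>H. subspace H \<and> H \<subseteq> X \<and> dim H + 1 = dim X \<and> w \<notin> H"
proof -
  have "independent {w}" using w(2) by simp
  then obtain C where C: "{w} \<subseteq> C" "C \<subseteq> X" "independent C" "X \<subseteq> span C"
    using maximal_independent_subset_extend[of "{w}" X] w(1) by blast
  have fin: "finite C" using C(3) finiteI_independent by blast
  have "w \<notin> span (C - {w})" using C(1,3) by (auto simp: dependent_def)
  moreover have "span (C - {w}) \<subseteq> X" using C(2) X by (intro span_minimal) auto
  moreover have "dim X = card C" using basis_card_eq_dim[OF C(2,4,3)] by simp
  moreover have "dim (span (C - {w})) = card C - 1"
    using C(1) fin dim_span_eq_card_independent[OF independent_mono[OF C(3) Diff_subset]] by simp
  moreover have "card C > 0" using C(1) fin by (auto simp: card_gt_0_iff)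
  ultimately show ?thesis by (intro exI[of _ "span (C - {w})"]) auto
qed

text \<open>The hyperplanes of \<open>X\<close> have intersection \<open>0\<close>, so \<open>r\<close> of them cut \<open>H0\<close> down to dimension
  \<open>t - 1\<close>. Fewer than \<open>r + 1\<close> hyperplanes would meet in dimension at least \<open>t\<close>, hence the hyperplanes
  found are distinct and their number is exactly \<open>r + 1\<close>.\<close>

lemma independent_hyperplanes:
  assumes X: "subspace X" "dim X = r + t" and t: "t \<ge> 1"
    and H0: "subspace H0" "H0 \<subseteq> X" "dim H0 + 1 = dim X"
  shows "\<exists>\<H>. H0 \<in> \<H> \<and> finite \<H> \<and> card \<H> = r + 1 \<and> dim (\<Inter>\<H>) < t \<and>
    (\<forall>H\<in>\<H>. subspace H \<and> H \<subseteq> X \<and> dim H + 1 = dim X)"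
proof -
  define \<G> where "\<G> = {H. subspace H \<and> H \<subseteq> X \<and> dim H + 1 = dim X}"
  have H0G: "H0 \<in> \<G>" using H0 by (simp add: \<G>_def)
  have "\<Inter>\<G> \<subseteq> {0}"
  proof
    fix w assume w: "w \<in> \<Inter>\<G>"
    then have "w \<in> X" using H0G H0(2) by blast
    then show "w \<in> {0}" using hyperplane_avoiding[OF X(1)] w by (auto simp: \<G>_def)
  qed
  then have "dim (\<Inter>\<G>) = 0" by simp
  then have "dim (\<Inter>\<G>) < t" using t by linarith
  then obtain A where A: "A \<subseteq> \<G>" "finite A" "card A \<le> r"
    "dim (H0 \<inter> \<Inter>A) \<le> max (t - 1) (dim H0 - r)"
    using exists_subfamily_cutting_down[of \<G> t H0 r] H0(1) by (auto simp: \<G>_def)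
  have lt: "dim (\<Inter>(insert H0 A)) < t" using A(4) H0(3) X(2) t by auto
  have "dim X \<le> dim (X \<inter> \<Inter>(insert H0 A)) + card (insert H0 A)"
    using A H0G X(1) by (intro dim_Inter_near) (auto simp: \<G>_def Int_absorb2)
  also have "X \<inter> \<Inter>(insert H0 A) = \<Inter>(insert H0 A)" using H0(2) by auto
  finally have "r + 1 \<le> card (insert H0 A)" using lt X(2) by linarith
  moreover have "card (insert H0 A) \<le> r + 1" using A(2,3) by (simp add: card_insert_if)
  ultimately have "card (insert H0 A) = r + 1" by simp
  then show ?thesis using lt A H0G by (intro exI[of _ "insert H0 A"]) (auto simp: \<G>_def)
qed

text \<open>Allowing repetitions among the \<open>r\<close> members amounts to allowing fewer than \<open>r\<close> of them.\<close>

lemma wise_intersecting_Inter: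
  assumes "wise_intersecting r t \<F>" "finite A" "A \<subseteq> \<F>" "A \<noteq> {}" "card A \<le> r"
  shows "t \<le> dim (\<Inter>A)"
proof -
  obtain h where h: "bij_betw h {1..card A} A" using ex_bij_betw_nat_finite_1[OF assms(2)] by blast
  have pos: "card A \<ge> 1" using assms(2,4) by (simp add: Suc_leI card_gt_0_iff)
  define f where "f i = (if i \<le> card A then h i else h 1)" for i
  have hA: "h ` {1..card A} = A" using h by (simp add: bij_betw_def)
  have "f ` {1..r} = A"
  proof
    show "f ` {1..r} \<subseteq> A" using hA pos by (auto simp: f_def)
    show "A \<subseteq> f ` {1..r}"
    proof
      fix x assume "x \<in> A"
      then obtain i where "i \<in> {1..card A}" "x = h i" using hA by blast
      then show "x \<in> f ` {1..r}" using assms(5) by (intro image_eqI[of _ _ i]) (auto simp: f_def)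
    qed
  qed
  then show ?thesis
    using assms(1,3) unfolding wise_intersecting_def by (metis image_eqI subsetD)
qed

lemma wise_intersectingI:
  assumes "r \<ge> 1" "\<And>A. finite A \<Longrightarrow> A \<subseteq> \<F> \<Longrightarrow> card A \<le> r \<Longrightarrow> t \<le> dim (\<Inter>A)"
  shows "wise_intersecting r t \<F>"
  unfolding wise_intersecting_def
proof (intro allI impI)
  fix F :: "nat \<Rightarrow> 'b set" assume "\<forall>i\<in>{1..r}. F i \<in> \<F>"
  moreover have "card (F ` {1..r}) \<le> r" using card_image_le[of "{1..r}" F] by simp
  ultimately show "t \<le> dim (\<Inter>i\<in>{1..r}. F i)" by (intro assms(2)) auto
qed

lemma wise_intersecting_mono:
  "wise_intersecting r t \<F> \<Longrightarrow> \<G> \<subseteq> \<F> \<Longrightarrow> wise_intersecting r t \<G>"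
  unfolding wise_intersecting_def by blast

lemma wise_intersecting_near_subspaces:
  assumes "subspace X" "dim X = r + t" "r \<ge> 1"
  shows "wise_intersecting r t (near_subspaces X k)"
proof (rule wise_intersectingI[OF assms(3)])
  fix A assume A: "finite A" "A \<subseteq> near_subspaces X k" "card A \<le> r"
  have "dim X \<le> dim (X \<inter> \<Inter>A) + card A"
    using A(1,2) assms(1) by (intro dim_Inter_near) (auto simp: near_subspaces_def k_subspaces_def)
  moreover have "dim (X \<inter> \<Inter>A) \<le> dim (\<Inter>A)" by (intro dim_subset) auto
  ultimately show "t \<le> dim (\<Inter>A)" using assms(2) A(3) by linarith
qed

text \<open>If \<open>F \<inter> G\<close> were smaller, \<open>r - 2\<close> further members would cut it down below dimension \<open>t\<close>.\<close>

lemma wise_intersecting_pairwise: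
  assumes "wise_intersecting r t \<F>" "r \<ge> 2" "t \<ge> 1" "\<And>F. F \<in> \<F> \<Longrightarrow> subspace F"
    "dim (\<Inter>\<F>) < t" "F \<in> \<F>" "G \<in> \<F>"
  shows "r + t - 2 \<le> dim (F \<inter> G)"
proof -
  have s: "subspace (F \<inter> G)" using assms by (intro subspace_inter) auto
  obtain A where A: "A \<subseteq> \<F>" "finite A" "card A \<le> r - 2"
    "dim ((F \<inter> G) \<inter> \<Inter>A) \<le> max (t - 1) (dim (F \<inter> G) - (r - 2))"
    using exists_subfamily_cutting_down[OF assms(4,5) s, of "r - 2"] by blast
  have "card (insert F (insert G A)) \<le> card A + 2"
    using A(2) by (simp add: card_insert_if)
  then have "card (insert F (insert G A)) \<le> r"
    using A(3) assms(2) by linarith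
  then have "t \<le> dim (\<Inter>(insert F (insert G A)))"
    using A assms by (intro wise_intersecting_Inter[OF assms(1)]) auto
  also have "\<Inter>(insert F (insert G A)) = (F \<inter> G) \<inter> \<Inter>A" by auto
  finally show ?thesis using A(4) assms(2,3) by linarith
qed

text \<open>Modulo \<open>T1 \<inter> T2 \<inter> T3\<close> the three spaces are the sides of a triangle in the projective
  plane \<open>X = T1 + T2\<close>: no \<open>m\<close>-space lies in all of them. If \<open>F\<close> met \<open>X\<close> in
  dimension at most \<open>m\<close>, then \<open>F \<inter> X\<close> would coincide with each \<open>F \<inter> Ti\<close> and be a common \<open>m\<close>-space.\<close>

lemma three_kernels:
  assumes s: "subspace T1" "subspace T2" "subspace T3"
    and d: "dim T1 = m + 1" "dim T2 = m + 1" "dim T3 = m + 1"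
    and p: "m \<le> dim (T1 \<inter> T2)" "m \<le> dim (T3 \<inter> T1)" "m \<le> dim (T3 \<inter> T2)"
    and ne: "T1 \<noteq> T2" "\<not> T1 \<inter> T2 \<subseteq> T3"
  shows "dim (span (T1 \<union> T2)) = m + 2"
    and "\<And>F. subspace F \<Longrightarrow> m \<le> dim (F \<inter> T1) \<Longrightarrow> m \<le> dim (F \<inter> T2) \<Longrightarrow> m \<le> dim (F \<inter> T3) \<Longrightarrow>
      m + 1 \<le> dim (F \<inter> span (T1 \<union> T2))"
proof -
  note si = subspace_inter
  let ?X = "span (T1 \<union> T2)"
  have T12: "dim (T1 \<inter> T2) = m"
  proof (rule ccontr)
    assume "dim (T1 \<inter> T2) \<noteq> m"
    then have "m + 1 \<le> dim (T1 \<inter> T2)" using p(1) by simp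
    then have "T1 \<inter> T2 = T1" "T1 \<inter> T2 = T2"
      using s d by (intro subspace_dim_equal si; simp)+
    then show False using ne(1) by blast
  qed
  show dX: "dim ?X = m + 2" using dim_span_Un[OF s(1,2)] T12 d by simp
  have in_X: "T1 \<subseteq> ?X" "T2 \<subseteq> ?X" using span_superset by blast+
  \<comment> \<open>\<open>T3\<close> lies in the span of \<open>T1\<close> and \<open>T2\<close>, because it meets them in two different \<open>m\<close>-spaces.\<close>
  have neq: "\<not> (T3 \<inter> T1 = T3 \<inter> T2)"
  proof
    assume *: "T3 \<inter> T1 = T3 \<inter> T2"
    have "T3 \<inter> T1 = T1 \<inter> T2"
      using s * p T12 by (intro subspace_dim_equal si) auto
    then show False using ne(2) by blast
  qed
  let ?Y = "span (T3 \<inter> T1 \<union> T3 \<inter> T2)"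
  have "m + 1 \<le> dim ?Y"
  proof (rule ccontr)
    assume *: "\<not> m + 1 \<le> dim ?Y"
    have sup: "T3 \<inter> T1 \<union> T3 \<inter> T2 \<subseteq> ?Y" by (rule span_superset)
    have "T3 \<inter> T1 = ?Y"
      using s sup p * by (intro subspace_dim_equal si subspace_span) auto
    moreover have "T3 \<inter> T2 = ?Y"
      using s sup p * by (intro subspace_dim_equal si subspace_span) auto
    ultimately show False using neq by simp
  qed
  moreover have "?Y \<subseteq> T3" using s by (intro span_minimal) auto
  ultimately have "?Y = T3" using s d by (intro subspace_dim_equal) auto
  moreover have "?Y \<subseteq> ?X" by (intro span_mono) auto
  ultimately have in_X3: "T3 \<subseteq> ?X" by simp
  fix F assume F: "subspace F" "m \<le> dim (F \<inter> T1)" "m \<le> dim (F \<inter> T2)" "m \<le> dim (F \<inter> T3)"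
  show "m + 1 \<le> dim (F \<inter> ?X)"
  proof (rule ccontr)
    assume *: "\<not> m + 1 \<le> dim (F \<inter> ?X)"
    have eq: "F \<inter> T = F \<inter> ?X" if "T \<in> {T1, T2, T3}" for T
      using that s F in_X in_X3 * by (intro subspace_dim_equal si subspace_span) auto
    have "F \<inter> ?X = T1 \<inter> T2"
      using eq[of T1] eq[of T2] s F T12
      by (intro subspace_dim_equal si subspace_span) auto
    then show False using eq[of T3] ne(2) by auto
  qed
qed

end

section \<open>Counting subspaces over a finite field\<close>

text \<open>The order of the field is a parameter with an equation, because an abbreviation
  for it, whose body mentions no vector, would need the field as an extra type argument.\<close>

locale finite_field_space = finite_dimensional_vector_space scale Basis
  for scale :: "'a::{field,finite} \<Rightarrow> 'b::ab_group_add \<Rightarrow> 'b" and Basis +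
  fixes q :: nat
  assumes q_eq: "q = card (UNIV :: 'a set)"
begin

lemma q_ge_2: "2 \<le> q"
proof -
  have "card {0, 1 :: 'a} \<le> q" unfolding q_eq by (intro card_mono) auto
  then show ?thesis by simp
qed

lemma card_span_independent:
  assumes "finite C" "independent C"
  shows "finite (span C) \<and> card (span C) = q ^ card C"
  using assms
proof (induction C rule: finite_induct)
  case empty
  then show ?case by simp
next
  case (insert b C)
  have ind: "independent C" and b: "b \<notin> span C"
    using insert.prems insert.hyps by (auto simp: independent_insert)
  define h where "h = (\<lambda>(c, x). scale c b + x)"
  have "inj_on h (UNIV \<times> span C)"
  proof (rule inj_onI, clarsimp simp: h_def)
    fix c x c' x' assume x: "x \<in> span C" "x' \<in> span C"
      and eq: "scale c b + x = scale c' b + x'"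
    have "scale c b = scale c' b + x' - x" unfolding eq[symmetric] by simp
    then have e: "scale (c - c') b = x' - x" unfolding scale_left_diff_distrib by simp
    have "scale (c - c') b \<in> span C" unfolding e using x by (intro span_diff)
    have "c = c'"
    proof (rule ccontr)
      assume "c \<noteq> c'"
      then show False
        using b span_scale[OF \<open>scale (c - c') b \<in> span C\<close>, of "inverse (c - c')"] by simp
    qed
    then show "c = c' \<and> x = x'" using eq by simp
  qed
  moreover have "h ` (UNIV \<times> span C) = span (insert b C)"
  proof (rule set_eqI)
    fix x
    have "x \<in> h ` (UNIV \<times> span C) \<longleftrightarrow> (\<exists>c. x - scale c b \<in> span C)"
    proof
      assume "\<exists>c. x - scale c b \<in> span C"
      then obtain c where "x - scale c b \<in> span C" ..
      then show "x \<in> h ` (UNIV \<times> span C)"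
        by (intro image_eqI[of _ _ "(c, x - scale c b)"]) (auto simp: h_def)
    next
      assume "x \<in> h ` (UNIV \<times> span C)"
      then obtain c y where "y \<in> span C" "x = scale c b + y" by (auto simp: h_def)
      then have "x - scale c b \<in> span C" by simp
      then show "\<exists>c. x - scale c b \<in> span C" ..
    qed
    then show "x \<in> h ` (UNIV \<times> span C) \<longleftrightarrow> x \<in> span (insert b C)"
      by (simp add: span_breakdown_eq)
  qed
  ultimately have "bij_betw h (UNIV \<times> span C) (span (insert b C))" by (simp add: bij_betw_def)
  note bij = this
  have fin: "finite (UNIV \<times> span C :: ('a \<times> 'b) set)" using insert.IH[OF ind] by simp
  have "card (span (insert b C)) = card (UNIV \<times> span C :: ('a \<times> 'b) set)"
    using bij_betw_same_card[OF bij] by (rule sym)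
  also have "\<dots> = q * card (span C)" by (simp only: card_cartesian_product q_eq)
  also have "\<dots> = q ^ card (insert b C)" using insert.IH[OF ind] insert.hyps by simp
  finally show ?case using bij_betw_finite[OF bij] fin by blast
qed

lemma finite_UNIV_space: "finite (UNIV :: 'b set)"
  using card_span_independent[OF finite_Basis independent_Basis] unfolding span_Basis by (rule conjunct1)

lemma finite_space [simp]: "finite (A :: 'b set)"
  by (rule finite_subset[OF subset_UNIV finite_UNIV_space])

lemma finite_space_set [simp]: "finite (\<A> :: 'b set set)"
proof (rule finite_subset)
  show "finite (Pow (UNIV :: 'b set))" by (simp only: finite_Pow_iff finite_UNIV_space)
qed simp

lemma finite_space_set_set [simp]: "finite (\<A> :: 'b set set set)"
proof (rule finite_subset)
  show "finite (Pow (UNIV :: 'b set set))" by (simp only: finite_Pow_iff finite_space_set)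
qed simp

lemma card_subspace: assumes "subspace S" shows "card S = q ^ dim S"
proof -
  obtain C where C: "C \<subseteq> S" "independent C" "S \<subseteq> span C" "card C = dim S"
    using basis_exists by blast
  have "span C = S" using span_subspace[OF C(1,3) assms] .
  have a: "card (span C) = q ^ card C" using card_span_independent[OF finite_space C(2)] by (rule conjunct2)
  have b: "card S = q ^ card C" using a unfolding \<open>span C = S\<close> .
  show ?thesis using b unfolding C(4) .
qed

lemma card_k_subspace:
  assumes "F \<in> k_subspaces k"
  shows "card F = q ^ k"
proof -
  have F: "subspace F" "dim F = k" using assms unfolding k_subspaces_def by blast+
  show ?thesis using card_subspace[OF F(1)] unfolding F(2) .
qed

definition above :: "nat \<Rightarrow> 'b set \<Rightarrow> 'b set set" where
  "above k E = {F \<in> k_subspaces k. E \<subseteq> F}"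

text \<open>All \<open>j\<close>-dimensional subspaces lie in equally many \<open>k\<close>-dimensional ones (\<open>card_above\<close>), so the
  choice is immaterial.\<close>

definition above_count :: "nat \<Rightarrow> nat \<Rightarrow> nat" where
  "above_count k j = card (above k (SOME E. E \<in> k_subspaces j))"

text \<open>A linear bijection of the whole space that maps \<open>E\<close> to \<open>E'\<close> maps the \<open>k\<close>-spaces above \<open>E\<close>
  to those above \<open>E'\<close>.\<close>

lemma card_above_le:
  assumes "E \<in> k_subspaces j" "E' \<in> k_subspaces j"
  shows "card (above k E) \<le> card (above k E')"
proof -
  interpret P: finite_dimensional_vector_space_pair scale Basis scale Basis
    by unfold_locales
  have "subspace E" "subspace E'" "dim E = dim E'" using assms by (simp_all add: k_subspaces_def)
  from linear_bij_subspace[OF this]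
  obtain g where g: "Vector_Spaces.linear scale scale g" "bij g" "g ` E = E'"
    by (elim exE conjE)
  have inj: "inj g" using g(2) by (simp add: bij_def)
  have "inj_on ((`) g) (above k E)"
    by (rule inj_onI) (simp add: inj_image_eq_iff[OF inj])
  moreover have "(`) g ` above k E \<subseteq> above k E'"
  proof
    fix F' assume "F' \<in> (`) g ` above k E"
    then obtain F where F: "F \<in> k_subspaces k" "E \<subseteq> F" "F' = g ` F"
      by (auto simp: above_def)
    have "subspace (g ` F)" "dim (g ` F) = k"
      using F(1) P.linear_subspace_image[OF g(1)] P.dim_image_eq[OF g(1) inj_on_subset[OF inj subset_UNIV]]
      by (simp_all add: k_subspaces_def)
    moreover have "E' \<subseteq> g ` F" using F(2) g(3) by blast
    ultimately show "F' \<in> above k E'" using F(3) by (simp add: above_def k_subspaces_def)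
  qed
  ultimately show ?thesis by (rule card_inj_on_le) simp
qed

lemma card_above:
  assumes "E \<in> k_subspaces j"
  shows "card (above k E) = above_count k j"
proof -
  have "(SOME E. E \<in> k_subspaces j) \<in> k_subspaces j" using assms by (rule someI)
  then show ?thesis unfolding above_count_def
    using card_above_le assms by (intro antisym) blast+
qed

lemma span_insert_k_subspaces:
  assumes "T \<in> k_subspaces j" "v \<notin> T"
  shows "span (insert v T) \<in> k_subspaces (j + 1)"
proof -
  have T: "span T = T" "dim T = j" using assms(1) by (simp_all add: k_subspaces_def)
  have "dim (insert v T) = j + 1" unfolding dim_insert using assms(2) T by metis
  then show ?thesis by (simp add: k_subspaces_def)
qed

lemma above_insert_iff:
  assumes "T \<in> k_subspaces j" "v \<notin> T"
  shows "F \<in> above k (span (insert v T)) \<longleftrightarrow> F \<in> above k T \<and> v \<in> F"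
proof -
  have "subspace F \<Longrightarrow> span (insert v T) \<subseteq> F \<longleftrightarrow> insert v T \<subseteq> F"
    using span_superset span_minimal by (metis subset_trans)
  then show ?thesis by (auto simp: above_def k_subspaces_def)
qed

lemma card_above_insert:
  assumes "T \<in> k_subspaces j" "v \<notin> T"
  shows "card {F \<in> above k T. v \<in> F} = above_count k (j + 1)"
proof -
  have "{F \<in> above k T. v \<in> F} = above k (span (insert v T))"
    using above_insert_iff[OF assms] by blast
  then show ?thesis using card_above[OF span_insert_k_subspaces[OF assms]] by simp
qed

lemma exists_k_subspaces_above:
  assumes "subspace T" "dim T \<le> k" "k \<le> dim UNIV"
  shows "above k T \<noteq> {}"
proof -
  obtain C where C: "C \<subseteq> T" "independent C" "T \<subseteq> span C" "card C = dim T"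
    using basis_exists by blast
  obtain D where D: "C \<subseteq> D" "independent D" "span D = UNIV"
    using C(2) extend_basis_superset independent_extend_basis span_extend_basis by metis
  have "card D = dim UNIV" using D dim_span_eq_card_independent by metis
  then obtain E where E: "C \<subseteq> E" "E \<subseteq> D" "card E = k"
    using exists_subset_between[of C k D] C assms D(1) by auto
  have "T \<subseteq> span E" using C(3) span_mono[OF E(1)] by blast
  moreover have "dim (span E) = k"
    using dim_span_eq_card_independent[OF independent_mono[OF D(2) E(2)]] E(3) by simp
  ultimately have "span E \<in> above k T" unfolding above_def k_subspaces_def using subspace_span by blast
  then show ?thesis by blast
qed

lemma above_count_pos:
  assumes "j \<le> k" "k \<le> dim UNIV"
  shows "0 < above_count k j"
proof -
  have "above j {0} \<noteq> {}" using assms by (intro exists_k_subspaces_above) auto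
  then obtain E where E: "E \<in> k_subspaces j" by (auto simp: above_def)
  then have "above k E \<noteq> {}"
    using assms by (intro exists_k_subspaces_above) (auto simp: k_subspaces_def)
  then show ?thesis using card_above[OF E, of k] by (metis card_gt_0_iff finite_space_set)
qed

text \<open>Counting pairs of a \<open>k\<close>-space \<open>F \<supseteq> T\<close> and a vector \<open>v \<in> F - T\<close> in two ways, with \<open>n\<close> the
  dimension of the whole space, gives
  \<open>(q\<^sup>n - q\<^sup>j) d = (q\<^sup>k - q\<^sup>j) c\<close>. The quotient of the two factors is at least \<open>q\<^bsup>n-k\<^esup>\<close>.\<close>

lemma above_count_Suc:
  assumes "j \<le> k" "k < dim UNIV"
  shows "q ^ (dim UNIV - k) * above_count k (j + 1) \<le> above_count k j"
proof -
  let ?n = "dim UNIV" and ?c = "above_count k j" and ?d = "above_count k (j + 1)"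
  have "above j {0} \<noteq> {}" using assms by (intro exists_k_subspaces_above) auto
  then obtain T where T: "T \<in> k_subspaces j" by (auto simp: above_def)
  have cU: "card (UNIV :: 'b set) = q ^ ?n" using card_subspace[of UNIV] by simp
  have "(\<Sum>v\<in>UNIV - T. card {F \<in> above k T. v \<in> F}) = (\<Sum>F\<in>above k T. card {v \<in> UNIV - T. v \<in> F})"
    using sum.swap_restrict[of "UNIV - T" "above k T" "\<lambda>_ _. 1 :: nat" "\<lambda>v F. v \<in> F"] by simp
  also have "(\<Sum>v\<in>UNIV - T. card {F \<in> above k T. v \<in> F}) = (q ^ ?n - q ^ j) * ?d"
    using T by (simp add: card_above_insert card_Diff_subset cU card_k_subspace)
  also have "(\<Sum>F\<in>above k T. card {v \<in> UNIV - T. v \<in> F}) = (\<Sum>F\<in>above k T. q ^ k - q ^ j)"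
  proof (rule sum.cong[OF refl])
    fix F assume F: "F \<in> above k T"
    have "{v \<in> UNIV - T. v \<in> F} = F - T" by auto
    then show "card {v \<in> UNIV - T. v \<in> F} = q ^ k - q ^ j"
      using F T card_k_subspace[of F k] by (simp add: above_def card_Diff_subset card_k_subspace[OF T])
  qed
  also have "\<dots> = ?c * (q ^ k - q ^ j)" using card_above[OF T] by simp
  finally have eq: "(q ^ ?n - q ^ j) * ?d = ?c * (q ^ k - q ^ j)" .
  show ?thesis
  proof (cases "j = k")
    case True
    have "q ^ j < q ^ ?n" using True assms q_ge_2 by (simp add: power_strict_increasing)
    then have "?d = 0" using eq True by simp
    then show ?thesis by simp
  next
    case False
    have q1: "q \<ge> 1" using q_ge_2 by simp
    have "q ^ j \<le> q ^ (?n - k) * q ^ j" using q1 by simp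
    then have "q ^ (?n - k) * (q ^ k - q ^ j) \<le> q ^ ?n - q ^ j"
      using assms by (simp add: diff_mult_distrib2 flip: power_add)
    then have "q ^ (?n - k) * (q ^ k - q ^ j) * ?d \<le> ?c * (q ^ k - q ^ j)"
      unfolding eq[symmetric] by (rule mult_right_mono) simp
    moreover have "0 < q ^ k - q ^ j"
      using False assms q_ge_2 by (simp add: power_strict_increasing)
    ultimately show ?thesis by (simp add: mult.commute mult.left_commute)
  qed
qed

text \<open>A vector outside \<open>T\<close> lies in only few of the \<open>k\<close>-spaces above \<open>T\<close>, so at least half of these
  spaces avoid all vectors of a small set \<open>W\<close> outside \<open>T\<close>.\<close>

lemma card_avoiding:
  assumes T: "T \<in> k_subspaces j" and d: "2 * card W * above_count k (j + 1) \<le> above_count k j"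
  shows "above_count k j \<le> 2 * card {F \<in> above k T. F \<inter> W \<subseteq> T}"
proof -
  have "above k T \<subseteq> {F \<in> above k T. F \<inter> W \<subseteq> T} \<union> (\<Union>v\<in>W - T. {F \<in> above k T. v \<in> F})"
    by auto
  then have "card (above k T) \<le>
      card ({F \<in> above k T. F \<inter> W \<subseteq> T} \<union> (\<Union>v\<in>W - T. {F \<in> above k T. v \<in> F}))"
    by (intro card_mono) auto
  also have "\<dots> \<le> card {F \<in> above k T. F \<inter> W \<subseteq> T} + card (\<Union>v\<in>W - T. {F \<in> above k T. v \<in> F})"
    by (rule card_Un_le)
  also have "card (\<Union>v\<in>W - T. {F \<in> above k T. v \<in> F}) \<le>
      (\<Sum>v\<in>W - T. card {F \<in> above k T. v \<in> F})"
    by (rule card_UN_le) simp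
  also have "\<dots> = card (W - T) * above_count k (j + 1)"
    using T by (simp add: card_above_insert)
  also have "\<dots> \<le> card W * above_count k (j + 1)"
    by (intro mult_right_mono card_mono) auto
  finally show ?thesis using d card_above[OF T, of k] by simp
qed

section \<open>Kernels and nongeneric sets\<close>

text \<open>Every member of \<open>\<F>\<close> contains an \<open>m\<close>-space \<open>E\<close> of the fixed member \<open>F1\<close>. As
  \<open>E\<close> is not contained in \<open>\<Inter>\<F>\<close>, a member \<open>g E\<close> can be chosen that does not contain \<open>E\<close>; meeting
  \<open>g E\<close> in dimension \<open>m\<close> then requires a vector of \<open>g E - E\<close>. There are at most \<open>q\<^bsup>km\<^esup>\<close> choices for \<open>E\<close>
  (by a spanning list of \<open>m\<close> vectors of \<open>F1\<close>) and at most \<open>q\<^sup>k\<close> for the vector.\<close>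

lemma kernels_exist:
  assumes F: "\<F> \<subseteq> k_subspaces k" "F1 \<in> \<F>"
    and meet: "\<And>F G. F \<in> \<F> \<Longrightarrow> G \<in> \<F> \<Longrightarrow> m \<le> dim (F \<inter> G)"
    and nontrivial: "dim (\<Inter>\<F>) < m"
  shows "\<exists>\<K>. \<K> \<subseteq> k_subspaces (m + 1) \<and> card \<K> \<le> q ^ (k * m + k) \<and> (\<forall>F\<in>\<F>. \<exists>T\<in>\<K>. T \<subseteq> F)"
proof -
  define \<E> where "\<E> = {E \<in> k_subspaces m. E \<subseteq> F1}"
  have sub: "subspace F" if "F \<in> \<F>" for F using F(1) that by (auto simp: k_subspaces_def)
  have "\<exists>G. G \<in> \<F> \<and> \<not> E \<subseteq> G" if "E \<in> \<E>" for E
  proof (rule ccontr)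
    assume "\<nexists>G. G \<in> \<F> \<and> \<not> E \<subseteq> G"
    then have "dim E \<le> dim (\<Inter>\<F>)" by (intro dim_subset) blast
    then show False using that nontrivial by (simp add: \<E>_def k_subspaces_def)
  qed
  then obtain g where g: "\<And>E. E \<in> \<E> \<Longrightarrow> g E \<in> \<F>" "\<And>E. E \<in> \<E> \<Longrightarrow> \<not> E \<subseteq> g E" by metis
  define \<K> where "\<K> = (\<Union>E\<in>\<E>. (\<lambda>v. span (insert v E)) ` (g E - E))"
  have "\<E> \<subseteq> (\<lambda>xs. span (set xs)) ` {xs. set xs \<subseteq> F1 \<and> length xs = m}"
  proof
    fix E assume E: "E \<in> \<E>"
    obtain C where C: "C \<subseteq> E" "independent C" "E \<subseteq> span C" "card C = dim E"
      using basis_exists by blast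
    obtain xs where xs: "set xs = C" "distinct xs" using finite_distinct_list[OF finite_space] by blast
    have "length xs = m" using distinct_card[OF xs(2)] xs(1) C(4) E by (simp add: \<E>_def k_subspaces_def)
    moreover have "span (set xs) = E"
      using span_subspace[OF C(1,3)] E xs(1) by (simp add: \<E>_def k_subspaces_def)
    ultimately show "E \<in> (\<lambda>xs. span (set xs)) ` {xs. set xs \<subseteq> F1 \<and> length xs = m}"
      using E C(1) xs(1) by (intro image_eqI[of _ _ xs]) (auto simp: \<E>_def)
  qed
  then have "card \<E> \<le> card {xs. set xs \<subseteq> F1 \<and> length xs = m}"
    by (intro surj_card_le finite_lists_length_eq) simp_all
  also have "\<dots> = q ^ (k * m)"
    using F card_k_subspace[of F1 k] by (simp add: card_lists_length_eq power_mult subsetD)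
  finally have cE: "card \<E> \<le> q ^ (k * m)" .
  have "card \<K> \<le> (\<Sum>E\<in>\<E>. card ((\<lambda>v. span (insert v E)) ` (g E - E)))"
    unfolding \<K>_def by (rule card_UN_le) simp
  also have "\<dots> \<le> (\<Sum>E\<in>\<E>. q ^ k)"
  proof (rule sum_mono)
    fix E assume "E \<in> \<E>"
    have "card ((\<lambda>v. span (insert v E)) ` (g E - E)) \<le> card (g E - E)" by (rule card_image_le) simp
    also have "\<dots> \<le> card (g E)" by (rule card_mono) auto
    also have "\<dots> = q ^ k" using g(1)[OF \<open>E \<in> \<E>\<close>] F(1) by (intro card_k_subspace) blast
    finally show "card ((\<lambda>v. span (insert v E)) ` (g E - E)) \<le> q ^ k" .
  qed
  also have "\<dots> = card \<E> * q ^ k" by simp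
  also have "\<dots> \<le> q ^ (k * m) * q ^ k" using cE by (rule mult_right_mono) simp
  also have "\<dots> = q ^ (k * m + k)" by (rule power_add[symmetric])
  finally have cK: "card \<K> \<le> q ^ (k * m + k)" .
  have subK: "\<K> \<subseteq> k_subspaces (m + 1)"
  proof
    fix T assume "T \<in> \<K>"
    then obtain E v where "E \<in> \<E>" "v \<notin> E" "T = span (insert v E)" by (auto simp: \<K>_def)
    then show "T \<in> k_subspaces (m + 1)"
      using span_insert_k_subspaces[of E m v] by (simp add: \<E>_def)
  qed
  have "\<exists>T\<in>\<K>. T \<subseteq> F" if FF: "F \<in> \<F>" for F
  proof -
    obtain C where C: "C \<subseteq> F \<inter> F1" "independent C" "F \<inter> F1 \<subseteq> span C" "card C = dim (F \<inter> F1)"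
      using basis_exists by blast
    have "m \<le> card C" using meet[OF FF F(2)] C(4) by simp
    then obtain D where D: "D \<subseteq> C" "card D = m" using obtain_subset_with_card_n by metis
    let ?E = "span D"
    have "D \<subseteq> F" "D \<subseteq> F1" using D(1) C(1) by auto
    then have "?E \<subseteq> F" "?E \<subseteq> F1" using sub[OF FF] sub[OF F(2)] by (simp_all add: span_minimal)
    moreover have "dim ?E = m"
      using dim_span_eq_card_independent[OF independent_mono[OF C(2) D(1)]] D(2) by simp
    ultimately have E: "?E \<in> \<E>" "?E \<subseteq> F" using subspace_span by (auto simp: \<E>_def k_subspaces_def)
    have "\<not> F \<inter> g ?E \<subseteq> ?E"
    proof
      assume *: "F \<inter> g ?E \<subseteq> ?E"
      have "F \<inter> g ?E = ?E"
        using * meet[OF FF g(1)[OF E(1)]] \<open>dim ?E = m\<close> sub[OF FF] sub[OF g(1)[OF E(1)]]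
        by (intro subspace_dim_equal subspace_inter subspace_span) simp_all
      then show False using g(2)[OF E(1)] by blast
    qed
    then obtain v where v: "v \<in> F" "v \<in> g ?E" "v \<notin> ?E" by blast
    have "span (insert v ?E) \<subseteq> F" using v E(2) sub[OF FF] by (intro span_minimal) auto
    moreover have "span (insert v ?E) \<in> \<K>" using v E(1) by (auto simp: \<K>_def)
    ultimately show ?thesis by blast
  qed
  then show ?thesis using cK subK by blast
qed

lemma card_family_le:
  assumes "\<F> \<subseteq> k_subspaces k" "\<K> \<subseteq> k_subspaces j"
    and "\<And>F. F \<in> \<F> \<Longrightarrow> ker F \<in> \<K> \<and> ker F \<subseteq> F"
  shows "card \<F> \<le> card \<K> * above_count k j"
proof -
  have "\<F> \<subseteq> (\<Union>T\<in>\<K>. above k T)"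
  proof
    fix F assume "F \<in> \<F>"
    then have "ker F \<in> \<K>" "F \<in> above k (ker F)" using assms(1,3) unfolding above_def by blast+
    then show "F \<in> (\<Union>T\<in>\<K>. above k T)" by blast
  qed
  then have "card \<F> \<le> card (\<Union>T\<in>\<K>. above k T)" by (intro card_mono) auto
  also have "\<dots> \<le> (\<Sum>T\<in>\<K>. card (above k T))" by (rule card_UN_le) simp
  also have "\<dots> = (\<Sum>T\<in>\<K>. above_count k j)"
    using assms(2) by (intro sum.cong card_above) auto
  finally show ?thesis by simp
qed

text \<open>A member that meets \<open>h (ker F)\<close> outside its kernel contains a \<open>(j+1)\<close>-space spanned by the
  kernel and one of \<open>q\<^sup>k\<close> vectors. The \<open>k\<close>-space \<open>h T\<close> may depend on the kernel, as is
  needed for kernels that meet some member in too small a dimension.\<close>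

lemma few_exceptional:
  assumes F: "\<F> \<subseteq> k_subspaces k" and K: "\<K> \<subseteq> k_subspaces j"
    and ker: "\<And>F. F \<in> \<F> \<Longrightarrow> ker F \<in> \<K> \<and> ker F \<subseteq> F"
    and h: "\<And>T. T \<in> \<K> \<Longrightarrow> h T \<in> k_subspaces k"
  shows "card {F \<in> \<F>. \<not> F \<inter> h (ker F) \<subseteq> ker F} \<le> card \<K> * q ^ k * above_count k (j + 1)"
proof -
  have "{F \<in> \<F>. \<not> F \<inter> h (ker F) \<subseteq> ker F} \<subseteq> (\<Union>T\<in>\<K>. \<Union>v\<in>h T - T. {F \<in> above k T. v \<in> F})"
    (is "?A \<subseteq> ?B")
  proof
    fix F assume "F \<in> ?A"
    then obtain v where "F \<in> \<F>" "v \<in> F" "v \<in> h (ker F)" "v \<notin> ker F" by blast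
    moreover from this have "ker F \<in> \<K>" "F \<in> above k (ker F)" using F ker unfolding above_def by blast+
    ultimately show "F \<in> ?B" by blast
  qed
  then have "card ?A \<le> card ?B" by (intro card_mono) auto
  also have "\<dots> \<le> (\<Sum>T\<in>\<K>. card (\<Union>v\<in>h T - T. {F \<in> above k T. v \<in> F}))" by (rule card_UN_le) simp
  also have "\<dots> \<le> (\<Sum>T\<in>\<K>. q ^ k * above_count k (j + 1))"
  proof (rule sum_mono)
    fix T assume T: "T \<in> \<K>"
    have "card (\<Union>v\<in>h T - T. {F \<in> above k T. v \<in> F}) \<le> (\<Sum>v\<in>h T - T. card {F \<in> above k T. v \<in> F})"
      by (rule card_UN_le) simp
    also have "\<dots> = (\<Sum>v\<in>h T - T. above_count k (j + 1))"
      using T K by (intro sum.cong card_above_insert) auto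
    also have "\<dots> = card (h T - T) * above_count k (j + 1)" by simp
    also have "\<dots> \<le> card (h T) * above_count k (j + 1)" by (intro mult_right_mono card_mono) auto
    also have "card (h T) = q ^ k" using h[OF T] by (rule card_k_subspace)
    finally show "card (\<Union>v\<in>h T - T. {F \<in> above k T. v \<in> F}) \<le> q ^ k * above_count k (j + 1)" .
  qed
  finally show ?thesis by simp
qed

lemma card_supersets_le:
  fixes \<F> :: "'b set set"
  assumes "card A = a"
  shows "card {S. S \<subseteq> \<F> \<and> card S = a + b \<and> A \<subseteq> S} \<le> card \<F> ^ b"
proof -
  have "inj_on (\<lambda>S. S - A) {S. S \<subseteq> \<F> \<and> card S = a + b \<and> A \<subseteq> S}" by (rule inj_onI) blast
  moreover have "(\<lambda>S. S - A) ` {S. S \<subseteq> \<F> \<and> card S = a + b \<and> A \<subseteq> S} \<subseteq> {S. S \<subseteq> \<F> \<and> card S = b}"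
    using assms by (auto simp: card_Diff_subset)
  ultimately have "card {S. S \<subseteq> \<F> \<and> card S = a + b \<and> A \<subseteq> S} \<le> card {S. S \<subseteq> \<F> \<and> card S = b}"
    by (rule card_inj_on_le) simp
  also have "\<dots> = card \<F> choose b" by (rule n_subsets) simp
  also have "\<dots> \<le> card \<F> ^ b"
    by (cases "b \<le> card \<F>") (auto intro: binomial_le_pow simp: binomial_eq_0)
  finally show ?thesis .
qed

text \<open>The first condition compares the kernels with all of \<open>\<F>\<close>, so that a single generic simplex restricts the whole family.\<close>

definition generic :: "nat \<Rightarrow> 'b set set \<Rightarrow> ('b set \<Rightarrow> 'b set) \<Rightarrow> 'b set set \<Rightarrow> bool" where
  "generic m \<F> ker S \<longleftrightarrow>
    (\<forall>F\<in>S. (\<forall>G\<in>\<F>. m \<le> dim (ker F \<inter> G)) \<and> (\<forall>G\<in>S - {F}. F \<inter> G \<subseteq> ker F))"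

text \<open>If the kernel of \<open>F \<in> S\<close> meets some member of \<open>\<F>\<close> in dimension below \<open>m\<close>, then such a
  member can be chosen that depends only on the kernel, and \<open>F\<close> meets this member outside the kernel: the element \<open>F\<close> is exceptional, and the other
  \<open>r\<close> elements of \<open>S\<close> are free. If two elements \<open>F\<close>, \<open>G\<close> of \<open>S\<close> meet outside the kernel of \<open>F\<close>, then \<open>F\<close>
  is exceptional relative to \<open>G\<close>, and \<open>G\<close> and the other \<open>r - 1\<close> elements are free.\<close>

lemma card_nongeneric_le:
  assumes F: "\<F> \<subseteq> k_subspaces k" and K: "\<K> \<subseteq> k_subspaces (m + 1)"
    and ker: "\<And>F. F \<in> \<F> \<Longrightarrow> ker F \<in> \<K> \<and> ker F \<subseteq> F"
    and meet: "\<And>F G. F \<in> \<F> \<Longrightarrow> G \<in> \<F> \<Longrightarrow> m \<le> dim (F \<inter> G)"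
    and r: "r \<ge> 1"
  shows "card {S. S \<subseteq> \<F> \<and> card S = r + 1 \<and> \<not> generic m \<F> ker S} \<le>
    2 * (card \<K> * q ^ k * above_count k (m + 2)) * card \<F> ^ r" (is "card ?N \<le> 2 * ?b * _")
proof (cases "\<F> = {}")
  case True
  have "?N = {}" using True by auto
  then have "card ?N = 0" by (simp only: card.empty)
  then show ?thesis by linarith
next
  case False
  then obtain F0 where F0: "F0 \<in> \<F>" by blast
  \<comment> \<open>\<open>h T\<close> is a member that meets \<open>T\<close> in dimension below \<open>m\<close>, or the dummy value \<open>F0\<close> if there is none.\<close>
  define h where "h T = (if \<exists>G\<in>\<F>. dim (T \<inter> G) < m then SOME G. G \<in> \<F> \<and> dim (T \<inter> G) < m else F0)" for T
  have h: "h T \<in> \<F>" "(\<exists>G\<in>\<F>. dim (T \<inter> G) < m) \<Longrightarrow> dim (T \<inter> h T) < m" for T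
  proof -
    have *: "\<exists>G\<in>\<F>. dim (T \<inter> G) < m \<Longrightarrow> h T \<in> \<F> \<and> dim (T \<inter> h T) < m"
      unfolding h_def using someI_ex[of "\<lambda>G. G \<in> \<F> \<and> dim (T \<inter> G) < m"] by auto
    show "h T \<in> \<F>" using * F0 by (cases "\<exists>G\<in>\<F>. dim (T \<inter> G) < m") (auto simp: h_def)
    show "(\<exists>G\<in>\<F>. dim (T \<inter> G) < m) \<Longrightarrow> dim (T \<inter> h T) < m" using * by blast
  qed
  define A1 where "A1 = {F \<in> \<F>. \<not> F \<inter> h (ker F) \<subseteq> ker F}"
  define A2 where "A2 G = {F \<in> \<F>. \<not> F \<inter> G \<subseteq> ker F}" for G
  have j: "m + 1 + 1 = m + 2" by simp
  have c1: "card A1 \<le> ?b"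
    unfolding A1_def using few_exceptional[OF F K ker, of h, unfolded j] h(1) F by blast
  have c2: "card (A2 G) \<le> ?b" if "G \<in> \<F>" for G
    unfolding A2_def using few_exceptional[OF F K ker, of "\<lambda>_. G", unfolded j] that F by blast
  let ?U1 = "\<Union>F\<in>A1. {S. S \<subseteq> \<F> \<and> card S = 1 + r \<and> {F} \<subseteq> S}"
  let ?U2 = "\<Union>G\<in>\<F>. \<Union>F\<in>A2 G - {G}. {S. S \<subseteq> \<F> \<and> card S = 2 + (r - 1) \<and> {F, G} \<subseteq> S}"
  have "?N \<subseteq> ?U1 \<union> ?U2"
  proof
    fix S assume "S \<in> ?N"
    then have S: "S \<subseteq> \<F>" "card S = r + 1" "\<not> generic m \<F> ker S" by auto
    from S(3) consider F G where "F \<in> S" "G \<in> \<F>" "dim (ker F \<inter> G) < m"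
      | F G where "F \<in> S" "G \<in> S" "G \<noteq> F" "\<not> F \<inter> G \<subseteq> ker F"
      unfolding generic_def not_le[symmetric] by blast
    then show "S \<in> ?U1 \<union> ?U2"
    proof cases
      case 1
      have "dim (ker F \<inter> h (ker F)) < m" using 1 h(2) by blast
      moreover have "m \<le> dim (F \<inter> h (ker F))" using 1(1) S(1) h(1) by (intro meet) auto
      ultimately have "\<not> F \<inter> h (ker F) \<subseteq> ker F \<inter> h (ker F)"
        using dim_subset by (meson le_trans not_le)
      then have "F \<in> A1" using 1(1) S(1) by (auto simp: A1_def)
      then show ?thesis using 1(1) S by auto
    next
      case 2
      then have "F \<in> A2 G - {G}" "G \<in> \<F>" using S(1) by (auto simp: A2_def)
      then show ?thesis using 2 S r by auto
    qed
  qed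
  then have "card ?N \<le> card (?U1 \<union> ?U2)" by (intro card_mono) auto
  also have "\<dots> \<le> card ?U1 + card ?U2" by (rule card_Un_le)
  also have "card ?U1 \<le> (\<Sum>F\<in>A1. card \<F> ^ r)"
    by (rule order.trans[OF card_UN_le], simp, rule sum_mono, rule card_supersets_le, simp)
  also have "\<dots> = card A1 * card \<F> ^ r" by simp
  also have "\<dots> \<le> ?b * card \<F> ^ r" using c1 by (rule mult_right_mono) simp
  also have "card ?U2 \<le> (\<Sum>G\<in>\<F>. ?b * card \<F> ^ (r - 1))"
  proof (rule order.trans[OF card_UN_le], simp, rule sum_mono)
    fix G assume G: "G \<in> \<F>"
    have "card (\<Union>F\<in>A2 G - {G}. {S. S \<subseteq> \<F> \<and> card S = 2 + (r - 1) \<and> {F, G} \<subseteq> S}) \<le>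
        (\<Sum>F\<in>A2 G - {G}. card \<F> ^ (r - 1))"
      by (rule order.trans[OF card_UN_le], simp, rule sum_mono, rule card_supersets_le, auto)
    also have "\<dots> = card (A2 G - {G}) * card \<F> ^ (r - 1)" by simp
    also have "\<dots> \<le> card (A2 G) * card \<F> ^ (r - 1)" by (intro mult_right_mono card_mono) auto
    also have "\<dots> \<le> ?b * card \<F> ^ (r - 1)" using c2[OF G] by (rule mult_right_mono) simp
    finally show "card (\<Union>F\<in>A2 G - {G}. {S. S \<subseteq> \<F> \<and> card S = 2 + (r - 1) \<and> {F, G} \<subseteq> S}) \<le>
        ?b * card \<F> ^ (r - 1)" .
  qed
  also have "(\<Sum>G\<in>\<F>. ?b * card \<F> ^ (r - 1)) = ?b * (card \<F> * card \<F> ^ (r - 1))" by simp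
  also have "card \<F> * card \<F> ^ (r - 1) = card \<F> ^ r" using r by (simp flip: power_Suc)
  finally show ?thesis by simp
qed

text \<open>The elements of \<open>S\<close> meet exactly where their kernels meet, so the kernels inherit from \<open>S\<close>
  both the pairwise bound \<open>m\<close> and the small total intersection. This excludes a common \<open>m\<close>-space and
  provides the three kernels of \<open>three_kernels\<close>.\<close>

lemma generic_simplex_near:
  assumes F: "\<F> \<subseteq> k_subspaces k" and K: "\<K> \<subseteq> k_subspaces (m + 1)"
    and ker: "\<And>F. F \<in> \<F> \<Longrightarrow> ker F \<in> \<K> \<and> ker F \<subseteq> F"
    and meet: "\<And>F G. F \<in> \<F> \<Longrightarrow> G \<in> \<F> \<Longrightarrow> m \<le> dim (F \<inter> G)"
    and S: "S \<subseteq> \<F>" "card S \<ge> 2" "dim (\<Inter>S) < m" and gen: "generic m \<F> ker S"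
  shows "\<exists>X\<in>k_subspaces (m + 2). \<F> \<subseteq> near_subspaces X k"
proof -
  have kerT: "subspace (ker F)" "dim (ker F) = m + 1" if "F \<in> S" for F
    using that ker K S(1) by (auto simp: k_subspaces_def)
  have cover: "m \<le> dim (ker F \<inter> G)" if "F \<in> S" "G \<in> \<F>" for F G
    using gen that unfolding generic_def by blast
  have Int: "F \<inter> G \<subseteq> ker F" if "F \<in> S" "G \<in> S" "G \<noteq> F" for F G
    using gen that unfolding generic_def by blast
  have Int_dim: "m \<le> dim (ker F \<inter> ker G)" if "F \<in> S" "G \<in> S" for F G
  proof (cases "F = G")
    case True
    then show ?thesis using kerT[OF that(1)] by simp
  next
    case False
    then have "F \<inter> G \<subseteq> ker F \<inter> ker G" using Int[of F G] Int[of G F] that by blast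
    then have "dim (F \<inter> G) \<le> dim (ker F \<inter> ker G)" by (rule dim_subset)
    then show ?thesis using meet[of F G] that S(1) by (meson le_trans subsetD)
  qed
  have "\<Inter>(ker ` S) \<subseteq> \<Inter>S" using ker S(1) by blast
  then have small: "dim (\<Inter>(ker ` S)) < m" using S(3) dim_subset le_less_trans by blast
  have "S \<noteq> {}" using S(2) by auto
  then obtain F1 where F1: "F1 \<in> S" by blast
  have "\<exists>F2\<in>S. ker F2 \<noteq> ker F1"
  proof (rule ccontr)
    assume "\<not> (\<exists>F2\<in>S. ker F2 \<noteq> ker F1)"
    then have "ker ` S = {ker F1}" using F1 by blast
    then have "dim (\<Inter>(ker ` S)) = m + 1" using kerT(2)[OF F1] by (simp only: cInf_singleton)
    then show False using small by linarith
  qed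
  then obtain F2 where F2: "F2 \<in> S" "ker F1 \<noteq> ker F2" by metis
  have "\<exists>F3\<in>S. \<not> ker F1 \<inter> ker F2 \<subseteq> ker F3"
  proof (rule ccontr)
    assume "\<not> (\<exists>F3\<in>S. \<not> ker F1 \<inter> ker F2 \<subseteq> ker F3)"
    then have "dim (ker F1 \<inter> ker F2) \<le> dim (\<Inter>(ker ` S))" by (intro dim_subset) blast
    then show False using small Int_dim[OF F1 F2(1)] by linarith
  qed
  then obtain F3 where F3: "F3 \<in> S" "\<not> ker F1 \<inter> ker F2 \<subseteq> ker F3" by blast
  note T = three_kernels[OF kerT(1)[OF F1] kerT(1)[OF F2(1)] kerT(1)[OF F3(1)]
      kerT(2)[OF F1] kerT(2)[OF F2(1)] kerT(2)[OF F3(1)]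
      Int_dim[OF F1 F2(1)] Int_dim[OF F3(1) F1] Int_dim[OF F3(1) F2(1)] F2(2) F3(2)]
  let ?X = "span (ker F1 \<union> ker F2)"
  have "\<F> \<subseteq> near_subspaces ?X k"
  proof
    fix G assume G: "G \<in> \<F>"
    have "subspace G" using F G by (auto simp: k_subspaces_def)
    then have "m + 1 \<le> dim (G \<inter> ?X)"
      using cover[OF F1 G] cover[OF F2(1) G] cover[OF F3(1) G] by (intro T(2)) (simp_all only: Int_commute)
    then have "dim ?X \<le> dim (G \<inter> ?X) + 1" unfolding T(1) by linarith
    then show "G \<in> near_subspaces ?X k" using F G unfolding near_subspaces_def by blast
  qed
  moreover have "?X \<in> k_subspaces (m + 2)" using T(1) subspace_span unfolding k_subspaces_def by blast
  ultimately show ?thesis by blast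
qed

section \<open>Simplices in the extremal family\<close>

text \<open>Subspaces through independent hyperplanes of \<open>X\<close> could still share vectors outside \<open>X\<close>. One
  pair that meets inside \<open>X\<close> confines the total intersection to \<open>X\<close>, where it is the intersection of the
  hyperplanes.\<close>

lemma transversal_simplex:
  assumes X: "X \<in> k_subspaces (r + t)" "r \<ge> 1"
    and \<H>: "card \<H> = r + 1" "dim (\<Inter>\<H>) < t" "\<And>H. H \<in> \<H> \<Longrightarrow> dim H + 1 = dim X"
    and f: "\<And>H. H \<in> \<H> \<Longrightarrow> f H \<in> k_subspaces k \<and> f H \<inter> X = H"
    and two: "H0 \<in> \<H>" "H1 \<in> \<H>" "f H0 \<inter> f H1 \<subseteq> X"
  shows "f ` \<H> \<subseteq> near_subspaces X k" "is_simplex r t (f ` \<H>)"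
proof -
  have inj: "inj_on f \<H>" using f by (metis inj_onI)
  show near: "f ` \<H> \<subseteq> near_subspaces X k" using f \<H>(3) by (auto simp: near_subspaces_def)
  have "\<Inter>(f ` \<H>) \<subseteq> \<Inter>\<H>" using f two by blast
  then have "dim (\<Inter>(f ` \<H>)) < t" using \<H>(2) dim_subset le_less_trans by blast
  moreover have "wise_intersecting r t (f ` \<H>)"
    using X wise_intersecting_near_subspaces[of X r t k] wise_intersecting_mono near
    by (auto simp: k_subspaces_def)
  ultimately show "is_simplex r t (f ` \<H>)"
    using \<H>(1) f card_image[OF inj] by (auto simp: is_simplex_def k_subspaces_def)
qed

text \<open>Fix independent hyperplanes \<open>\<H>\<close> of \<open>X\<close>, one of them \<open>H0\<close>. Choose first \<open>F0\<close> with trace \<open>H0\<close> on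
  \<open>X\<close>, and then for each other hyperplane \<open>H\<close> a \<open>k\<close>-space that meets \<open>X + F0\<close> exactly in \<open>H\<close>. By
  \<open>card_avoiding\<close> each choice succeeds for at least \<open>c/2\<close> of the \<open>c\<close> spaces above \<open>H\<close>, and a simplex
  determines its choices, since the traces on \<open>X\<close> tell its elements apart. Starting with an arbitrary
  \<open>F0\<close> shows moreover that each member of the starred family occurs in a simplex.\<close>

lemma simplices_near_lower_bound:
  assumes X: "X \<in> k_subspaces (r + t)" and r: "r \<ge> 2" and t: "t \<ge> 1"
    and k: "r + t - 1 \<le> k" "k \<le> dim UNIV"
    and small: "2 * q ^ (k + r + t) * above_count k (r + t) \<le> above_count k (r + t - 1)"
  shows "above_count k (r + t - 1) ^ (r + 1) \<le> 2 ^ (r + 1) * num_simplices r t (near_subspaces X k)"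
    and "\<And>F. F \<in> near_subspaces_star X k \<Longrightarrow>
      \<exists>S. F \<in> S \<and> S \<subseteq> near_subspaces X k \<and> is_simplex r t S"
proof -
  define c where "c = above_count k (r + t - 1)"
  have sX: "subspace X" "dim X = r + t" using X by (auto simp: k_subspaces_def)
  have cpos: "c > 0" unfolding c_def using k by (rule above_count_pos)
  define G where "G F0 H = {F \<in> above k H. F \<inter> span (X \<union> F0) \<subseteq> H}" for F0 H
  define P where "P \<H> H0 F0 = PiE \<H> (\<lambda>H. if H = H0 then {F0} else G F0 H)" for \<H> H0 F0
  have avoid: "c \<le> 2 * card {F \<in> above k H. F \<inter> W \<subseteq> H}"
    if "subspace H" "dim H + 1 = dim X" "card W \<le> q ^ (k + r + t)" for H W
  proof -
    have H: "H \<in> k_subspaces (r + t - 1)" using that sX by (simp add: k_subspaces_def)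
    have e: "r + t - 1 + 1 = r + t" using r by simp
    have "2 * card W * above_count k (r + t) \<le> 2 * q ^ (k + r + t) * above_count k (r + t)"
      using that(3) by simp
    then show ?thesis
      using card_avoiding[OF H, of W k, unfolded e] small unfolding c_def by linarith
  qed
  have cardW: "card (span (X \<union> F0)) \<le> q ^ (k + r + t)" if "F0 \<in> k_subspaces k" for F0
  proof -
    have F0: "subspace F0" "dim F0 = k" using that by (auto simp: k_subspaces_def)
    have "dim (span (X \<union> F0)) \<le> k + r + t" using dim_span_Un[OF sX(1) F0(1)] sX(2) F0(2) by linarith
    then have "q ^ dim (span (X \<union> F0)) \<le> q ^ (k + r + t)" using q_ge_2 by (intro power_increasing) simp_all
    then show ?thesis using card_subspace[OF subspace_span] by metis
  qed
  have cardX: "card X \<le> q ^ (k + r + t)"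
    unfolding card_subspace[OF sX(1)] sX(2) using q_ge_2 by (intro power_increasing) simp_all
  define hyps where "hyps \<H> \<longleftrightarrow> finite \<H> \<and> card \<H> = r + 1 \<and> dim (\<Inter>\<H>) < t \<and>
    (\<forall>H\<in>\<H>. subspace H \<and> H \<subseteq> X \<and> dim H + 1 = dim X)" for \<H> :: "'b set set"
  have Pcard: "c ^ r \<le> 2 ^ r * card (P \<H> H0 F0)"
    if \<H>: "hyps \<H>" "H0 \<in> \<H>" and F0: "F0 \<in> k_subspaces k" for \<H> H0 F0
  proof -
    have fin: "finite \<H>" and card: "card \<H> = r + 1" using \<H>(1) by (auto simp: hyps_def)
    have "card (P \<H> H0 F0) = (\<Prod>H\<in>\<H>. card (if H = H0 then {F0} else G F0 H))"
      unfolding P_def by (rule card_PiE[OF fin])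
    also have "\<dots> = (\<Prod>H\<in>\<H> - {H0}. card (G F0 H))"
      unfolding prod.remove[OF fin \<H>(2)] by simp
    finally have eq: "card (P \<H> H0 F0) = (\<Prod>H\<in>\<H> - {H0}. card (G F0 H))" .
    have "c ^ r = (\<Prod>H\<in>\<H> - {H0}. c)" using card \<H>(2) fin by simp
    also have "\<dots> \<le> (\<Prod>H\<in>\<H> - {H0}. 2 * card (G F0 H))"
    proof (rule prod_mono)
      fix H assume "H \<in> \<H> - {H0}"
      then show "0 \<le> c \<and> c \<le> 2 * card (G F0 H)"
        unfolding G_def using \<H>(1) cardW[OF F0] by (intro conjI avoid) (auto simp: hyps_def)
    qed
    also have "\<dots> = 2 ^ r * card (P \<H> H0 F0)"
      unfolding eq prod.distrib using card \<H>(2) fin by simp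
    finally show ?thesis .
  qed
  have PD: "f H \<in> (if H = H0 then {F0} else G F0 H)" if "f \<in> P \<H> H0 F0" "H \<in> \<H>" for f \<H> H0 F0 H
    using PiE_mem[OF that(1)[unfolded P_def] that(2)] .
  have Pvals: "f H \<in> k_subspaces k \<and> f H \<inter> X = H"
    if "hyps \<H>" "F0 \<in> k_subspaces k" "F0 \<inter> X = H0" "f \<in> P \<H> H0 F0" "H \<in> \<H>" for \<H> H0 F0 f H
  proof (cases "H = H0")
    case True
    then show ?thesis using PD[OF that(4,5)] that(2,3) by simp
  next
    case False
    then have "f H \<in> G F0 H" using PD[OF that(4,5)] by simp
    moreover have "X \<subseteq> span (X \<union> F0)" using span_superset by blast
    moreover have "H \<subseteq> X" using that by (auto simp: hyps_def)
    ultimately show ?thesis by (auto simp: G_def above_def)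
  qed
  have Psimplex: "F0 \<in> f ` \<H> \<and> f ` \<H> \<subseteq> near_subspaces X k \<and> is_simplex r t (f ` \<H>)"
    if \<H>: "hyps \<H>" "H0 \<in> \<H>" and F0: "F0 \<in> k_subspaces k" "F0 \<inter> X = H0"
      and f: "f \<in> P \<H> H0 F0" for \<H> H0 F0 f
  proof -
    have fH0: "f H0 = F0" using PD[OF f \<H>(2)] by simp
    have "card \<H> \<noteq> 1" using \<H>(1) r by (simp add: hyps_def)
    then have "\<H> \<noteq> {H0}" by auto
    then obtain H1 where H1: "H1 \<in> \<H>" "H1 \<noteq> H0" using \<H>(2) by blast
    have "f H1 \<in> G F0 H1" using PD[OF f H1(1)] H1(2) by simp
    then have "f H1 \<inter> F0 \<subseteq> H1" using span_superset[of "X \<union> F0"] by (auto simp: G_def)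
    moreover have "H1 \<subseteq> X" using \<H>(1) H1 by (auto simp: hyps_def)
    ultimately have sub: "f H0 \<inter> f H1 \<subseteq> X" using fH0 by blast
    have "r \<ge> 1" using r by simp
    moreover have "card \<H> = r + 1" "dim (\<Inter>\<H>) < t" "\<And>H. H \<in> \<H> \<Longrightarrow> dim H + 1 = dim X"
      using \<H>(1) by (auto simp: hyps_def)
    ultimately have "f ` \<H> \<subseteq> near_subspaces X k" "is_simplex r t (f ` \<H>)"
      using transversal_simplex[OF X, of \<H> f k H0 H1] Pvals[OF \<H>(1) F0 f] \<H>(2) H1(1) sub
      by blast+
    then show ?thesis using fH0 \<H>(2) by blast
  qed
  have hyps_ex: "\<exists>\<H>. hyps \<H> \<and> H0 \<in> \<H>"
    if "subspace H0" "H0 \<subseteq> X" "dim H0 + 1 = dim X" for H0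
    using independent_hyperplanes[OF sX t that] unfolding hyps_def by blast
  show "\<exists>S. F \<in> S \<and> S \<subseteq> near_subspaces X k \<and> is_simplex r t S"
    if F: "F \<in> near_subspaces_star X k" for F
  proof -
    have Fk: "F \<in> k_subspaces k" "subspace F" "dim (F \<inter> X) + 1 = dim X"
      using F by (auto simp: near_subspaces_star_def k_subspaces_def)
    have "subspace (F \<inter> X)" using Fk(2) sX(1) by (rule subspace_inter)
    then obtain \<H> where \<H>: "hyps \<H>" "F \<inter> X \<in> \<H>" using hyps_ex[of "F \<inter> X"] Fk(3) by blast
    have "c ^ r > 0" using cpos by simp
    then have "P \<H> (F \<inter> X) F \<noteq> {}" using Pcard[OF \<H> Fk(1)] by (metis card.empty mult_0_right not_le)
    then obtain f where f: "f \<in> P \<H> (F \<inter> X) F" by blast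
    show ?thesis using Psimplex[OF \<H> Fk(1) refl f] by blast
  qed
  have "X \<noteq> {0}" using sX r by auto
  then obtain w where "w \<in> X" "w \<noteq> 0" using subspace_0[OF sX(1)] by blast
  then obtain H0 where H0: "subspace H0" "H0 \<subseteq> X" "dim H0 + 1 = dim X"
    using hyperplane_avoiding[OF sX(1)] by blast
  obtain \<H> where \<H>: "hyps \<H>" "H0 \<in> \<H>" using hyps_ex[OF H0] by blast
  define A where "A = {F \<in> above k H0. F \<inter> X \<subseteq> H0}"
  have A: "F \<in> k_subspaces k \<and> F \<inter> X = H0" if "F \<in> A" for F
    using that H0(2) by (auto simp: A_def above_def)
  have cA: "c \<le> 2 * card A" unfolding A_def using H0(1,3) cardX by (rule avoid)
  define U where "U = (\<Union>F0\<in>A. P \<H> H0 F0)"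
  have finP: "finite (P \<H> H0 F0)" for F0
    unfolding P_def using \<H>(1) by (intro finite_PiE) (auto simp: hyps_def)
  have "c ^ (r + 1) \<le> 2 * card A * c ^ r" using cA by simp
  also have "\<dots> = 2 * (\<Sum>F0\<in>A. c ^ r)" by simp
  also have "\<dots> \<le> 2 * (\<Sum>F0\<in>A. 2 ^ r * card (P \<H> H0 F0))"
    using A Pcard[OF \<H>] by (intro mult_left_mono sum_mono) auto
  also have "\<dots> = 2 ^ (r + 1) * (\<Sum>F0\<in>A. card (P \<H> H0 F0))" by (simp add: sum_distrib_left mult.assoc)
  also have "(\<Sum>F0\<in>A. card (P \<H> H0 F0)) = card U"
    unfolding U_def
  proof (rule card_UN_disjoint[symmetric])
    have "f H0 = F0" if "f \<in> P \<H> H0 F0" for f F0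
      using PD[OF that \<H>(2)] by simp
    then show "\<forall>i\<in>A. \<forall>j\<in>A. i \<noteq> j \<longrightarrow> P \<H> H0 i \<inter> P \<H> H0 j = {}" by blast
  qed (simp_all add: finP)
  also have "card U \<le> num_simplices r t (near_subspaces X k)"
    unfolding num_simplices_def
  proof (rule card_inj_on_le)
    show "inj_on (\<lambda>f. f ` \<H>) U"
    proof (rule inj_onI)
      fix f g assume fg: "f \<in> U" "g \<in> U" "f ` \<H> = g ` \<H>"
      have tr: "h H \<inter> X = H" if "h \<in> U" "H \<in> \<H>" for h H
        using that Pvals[OF \<H>(1)] A unfolding U_def by blast
      have ext: "h \<in> extensional \<H>" if "h \<in> U" for h
        using that unfolding U_def P_def by (auto simp: PiE_iff)
      show "f = g"
      proof (rule extensionalityI[OF ext[OF fg(1)] ext[OF fg(2)]])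
        fix H assume H: "H \<in> \<H>"
        then obtain H' where H': "H' \<in> \<H>" "f H = g H'" using fg(3) by blast
        then have "H = H'" using tr[OF fg(1) H] tr[OF fg(2) H'(1)] by simp
        then show "f H = g H" using H'(2) by simp
      qed
    qed
    show "(\<lambda>f. f ` \<H>) ` U \<subseteq> {S. S \<subseteq> near_subspaces X k \<and> is_simplex r t S}"
      using Psimplex[OF \<H>] A unfolding U_def by blast
  qed simp
  finally show "above_count k (r + t - 1) ^ (r + 1) \<le>
      2 ^ (r + 1) * num_simplices r t (near_subspaces X k)"
    unfolding c_def by simp
qed

text \<open>The other \<open>r\<close> elements of a simplex meet inside \<open>X\<close> in dimension at least \<open>t\<close>. An element
  containing \<open>X\<close> would contain this intersection.\<close>

lemma simplex_near_star:
  assumes X: "X \<in> k_subspaces (r + t)" and S: "S \<subseteq> near_subspaces X k" "is_simplex r t S"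
  shows "S \<subseteq> near_subspaces_star X k"
proof
  fix F assume F: "F \<in> S"
  have sX: "subspace X" "dim X = r + t" using X by (auto simp: k_subspaces_def)
  have Fk: "F \<in> k_subspaces k" "subspace F" "dim X \<le> dim (F \<inter> X) + 1"
    using F S(1) by (auto simp: near_subspaces_def k_subspaces_def)
  have "dim (F \<inter> X) + 1 = dim X"
  proof (rule ccontr)
    assume "dim (F \<inter> X) + 1 \<noteq> dim X"
    then have "dim X \<le> dim (F \<inter> X)" using Fk(3) by linarith
    then have "F \<inter> X = X" using sX Fk(2) by (intro subspace_dim_equal subspace_inter) auto
    then have XF: "X \<inter> \<Inter>(S - {F}) \<subseteq> \<Inter>S" by blast
    have "dim X \<le> dim (X \<inter> \<Inter>(S - {F})) + card (S - {F})"
      using S(1) sX(1) by (intro dim_Inter_near) (auto simp: near_subspaces_def k_subspaces_def)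
    moreover have "card (S - {F}) = r" using S(2) F by (simp add: is_simplex_def)
    ultimately have "t \<le> dim (\<Inter>S)" using dim_subset[OF XF] sX(2) by linarith
    then show False using S(2) by (simp add: is_simplex_def)
  qed
  then show "F \<in> near_subspaces_star X k" using Fk(1) by (simp add: near_subspaces_star_def)
qed

section \<open>The extremal theorem\<close>

text \<open>The arithmetic behind the assumption on \<open>n\<close>. The first exponent collects the constant
  \<open>2\<^bsup>r+3\<^esup>\<close>, the \<open>r + 1\<close> factors bounding the number of kernels and one factor \<open>q\<^sup>k\<close>; the second is the
  cardinality bound needed for generic extensions.\<close>

lemma exponent_bound:
  fixes k r t n :: nat
  assumes "t \<ge> 1" "r \<ge> 2" "k \<ge> r + t - 1" "n \<ge> 3 * k * r ^ 2 + 3 * k * r * t"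
  shows "(r + 2) + (k * (r + t - 2) + k) * (r + 1) + k + 1 \<le> n - k"
    and "1 + (k + r + t) \<le> n - k" and "k < n" and "r + t \<le> n"
proof -
  have k2: "k \<ge> 2" using assms by linarith
  define s where "s = r + t - 1"
  have s: "s + 1 = r + t" "s \<le> k" using assms by (auto simp: s_def)
  have "r + t - 2 + 1 = s" using assms by (simp add: s_def)
  then have ks: "k * (r + t - 2) + k = k * s" by (metis mult.right_neutral distrib_left)
  have rt: "t + 1 \<le> r * t"
  proof -
    have "2 * t \<le> r * t" using assms(2) by (rule mult_right_mono) simp
    then show ?thesis using assms(1) by linarith
  qed
  have r2: "2 * r \<le> r ^ 2" using assms(2) by (simp add: power2_eq_square)
  have "(s + 1) * (r + 1) = (r + t) * (r + 1)" using s(1) by simp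
  then have e: "s * (r + 1) + 1 = r ^ 2 + r * t + t"
    by (simp add: algebra_simps power2_eq_square)
  have "s * (r + 1) + 2 = r ^ 2 + r * t + t + 1" using e by linarith
  then have "s * (r + 1) + 2 \<le> r ^ 2 + 2 * (r * t)" using rt by linarith
  then have "k * (s * (r + 1) + 2) \<le> k * (r ^ 2 + 2 * (r * t))" by (rule mult_left_mono) simp
  moreover have "r + 3 \<le> k * r ^ 2"
  proof -
    have "2 * r ^ 2 \<le> k * r ^ 2" using k2 by (rule mult_right_mono) simp
    then show ?thesis using r2 assms(2) by linarith
  qed
  moreover have "k * (s * (r + 1) + 2) = k * s * (r + 1) + 2 * k" by (simp add: algebra_simps)
  moreover have "k * (r ^ 2 + 2 * (r * t)) = k * r ^ 2 + 2 * (k * r * t)" by (simp add: algebra_simps)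
  ultimately have main: "r + 3 + k * s * (r + 1) + 2 * k \<le> n" using assms(4) by linarith
  then show "(r + 2) + (k * (r + t - 2) + k) * (r + 1) + k + 1 \<le> n - k" unfolding ks by linarith
  have "k * s * 3 \<le> k * s * (r + 1)" using assms(2) by (intro mult_left_mono) auto
  moreover have "2 * s \<le> k * s" using k2 by (rule mult_right_mono) simp
  ultimately have "s \<le> k * s * (r + 1)" using s(1) assms by linarith
  then show "1 + (k + r + t) \<le> n - k" "r + t \<le> n" "k < n" using main s(1) assms(2) by linarith+
qed

theorem simplex_count:
  assumes n: "dim (UNIV :: 'b set) = n"
    and t: "t \<ge> 1" and r: "r \<ge> 2" and k: "k \<ge> r + t - 1" and large: "n \<ge> 3 * k * r^2 + 3 * k * r * t"
    and F: "\<F> \<subseteq> k_subspaces k" and wise: "wise_intersecting r t \<F>"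
  shows "num_simplices r t \<F> \<le> extremal_number r t k \<and>
    (num_simplices r t \<F> = extremal_number r t k \<longleftrightarrow>
      (\<exists>X \<in> k_subspaces (r + t). near_subspaces_star X k \<subseteq> \<F> \<and> \<F> \<subseteq> near_subspaces X k))"
proof -
  define m where "m = r + t - 2"
  have m: "m + 1 = r + t - 1" "m + 2 = r + t" "t \<le> m" using t r by (auto simp: m_def)
  define c d where "c = above_count k (m + 1)" and "d = above_count k (m + 2)"
  note exps = exponent_bound[OF t r k large]
  have km: "m + 1 \<le> k" "k < dim (UNIV :: 'b set)" using k m(1) exps(3) n by auto
  have cpos: "c > 0" unfolding c_def using km by (intro above_count_pos) auto
  have cd: "q ^ (n - k) * d \<le> c"
    using above_count_Suc[OF km] unfolding n c_def d_def by simp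
  have small: "2 * q ^ (k + r + t) * above_count k (r + t) \<le> above_count k (r + t - 1)"
  proof -
    have "2 * q ^ (k + r + t) \<le> q * q ^ (k + r + t)" using q_ge_2 by (rule mult_right_mono) simp
    also have "\<dots> = q ^ (1 + (k + r + t))" by simp
    also have "\<dots> \<le> q ^ (n - k)" using exps(2) q_ge_2 by (intro power_increasing) auto
    finally have "2 * q ^ (k + r + t) * d \<le> q ^ (n - k) * d" by (rule mult_right_mono) simp
    then show ?thesis using cd unfolding c_def d_def m by linarith
  qed
  have ext: "extremal_number r t k = num_simplices r t (near_subspaces X k)" if "X \<in> k_subspaces (r + t)" for X
    using that by (intro extremal_number_eq) (simp add: add.commute)
  have lower: "c ^ (r + 1) \<le> 2 ^ (r + 1) * num_simplices r t (near_subspaces X k)"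
    and through: "\<And>F. F \<in> near_subspaces_star X k \<Longrightarrow>
      \<exists>S. F \<in> S \<and> S \<subseteq> near_subspaces X k \<and> is_simplex r t S"
    if "X \<in> k_subspaces (r + t)" for X
    using simplices_near_lower_bound[OF that r t k less_imp_le[OF km(2)] small] unfolding c_def m by blast+
  have mono: "num_simplices r t \<F> \<le> num_simplices r t (near_subspaces X k)" if "\<F> \<subseteq> near_subspaces X k" for X
    unfolding num_simplices_def using that by (intro card_mono) auto
  have extpos: "c ^ (r + 1) \<le> 2 ^ (r + 1) * extremal_number r t k"
  proof -
    have "above (r + t) {0} \<noteq> {}" using exps(4) n by (intro exists_k_subspaces_above) auto
    then obtain X where X: "X \<in> k_subspaces (r + t)" by (auto simp: above_def)
    show ?thesis using lower[OF X] ext[OF X] by simp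
  qed
  \<comment> \<open>A family inside the extremal family of some \<open>X\<close> satisfies the theorem with this \<open>X\<close>.\<close>
  have if_near: "num_simplices r t \<F> \<le> extremal_number r t k \<and>
    (num_simplices r t \<F> = extremal_number r t k \<longleftrightarrow> near_subspaces_star X k \<subseteq> \<F>)"
    if X: "X \<in> k_subspaces (r + t)" and near: "\<F> \<subseteq> near_subspaces X k" for X
  proof (intro conjI iffI)
    let ?S = "\<lambda>\<F>. {S. S \<subseteq> \<F> \<and> is_simplex r t S}"
    show "num_simplices r t \<F> \<le> extremal_number r t k" using mono[OF near] ext[OF X] by simp
    have sub: "?S \<F> \<subseteq> ?S (near_subspaces X k)" using near by blast
    {
      assume "num_simplices r t \<F> = extremal_number r t k"
      then have "?S \<F> = ?S (near_subspaces X k)"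
        using sub ext[OF X] unfolding num_simplices_def by (intro card_subset_eq) auto
      note eq = this
      show "near_subspaces_star X k \<subseteq> \<F>"
      proof
        fix F assume "F \<in> near_subspaces_star X k"
        then obtain S where S: "F \<in> S" "S \<subseteq> near_subspaces X k" "is_simplex r t S"
          using through[OF X] by meson
        then have "S \<in> ?S \<F>" unfolding eq by simp
        then show "F \<in> \<F>" using S(1) by blast
      qed
    next
      assume star: "near_subspaces_star X k \<subseteq> \<F>"
      have "?S (near_subspaces X k) \<subseteq> ?S \<F>"
      proof
        fix S assume "S \<in> ?S (near_subspaces X k)"
        then have S: "S \<subseteq> near_subspaces X k" "is_simplex r t S" by simp_all
        have "S \<subseteq> \<F>" using simplex_near_star[OF X S] star by (rule subset_trans)
        then show "S \<in> ?S \<F>" using S(2) by simp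
      qed
      then have "?S \<F> = ?S (near_subspaces X k)" using sub by (rule subset_antisym[rotated])
      then show "num_simplices r t \<F> = extremal_number r t k"
        unfolding ext[OF X] num_simplices_def by simp
    }
  qed
  show ?thesis
  proof (cases "\<exists>X\<in>k_subspaces (r + t). \<F> \<subseteq> near_subspaces X k")
    case True
    then obtain X where X: "X \<in> k_subspaces (r + t)" "\<F> \<subseteq> near_subspaces X k" ..
    show ?thesis
    proof (intro conjI iffI)
      show "num_simplices r t \<F> \<le> extremal_number r t k" using if_near[OF X] by (rule conjunct1)
    next
      assume "num_simplices r t \<F> = extremal_number r t k"
      then have "near_subspaces_star X k \<subseteq> \<F>" using if_near[OF X] by simp
      then show "\<exists>X\<in>k_subspaces (r + t). near_subspaces_star X k \<subseteq> \<F> \<and> \<F> \<subseteq> near_subspaces X k"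
        using X by (intro bexI[of _ X] conjI)
    next
      assume "\<exists>X\<in>k_subspaces (r + t). near_subspaces_star X k \<subseteq> \<F> \<and> \<F> \<subseteq> near_subspaces X k"
      then obtain Y where Y: "Y \<in> k_subspaces (r + t)" "near_subspaces_star Y k \<subseteq> \<F>"
        "\<F> \<subseteq> near_subspaces Y k" by (elim bexE conjE)
      show "num_simplices r t \<F> = extremal_number r t k" using if_near[OF Y(1,3)] Y(2) by simp
    qed
  next
    case False
    \<comment> \<open>Outside all extremal families there is no generic simplex, and the inequality is strict.\<close>
    have "num_simplices r t \<F> < extremal_number r t k"
    proof (cases "\<exists>S\<subseteq>\<F>. is_simplex r t S")
      case no: False
      then have "num_simplices r t \<F> = 0" unfolding num_simplices_def by simp
      moreover have "0 < c ^ (r + 1)" using cpos by simp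
      ultimately show ?thesis using extpos by (cases "extremal_number r t k") auto
    next
      case True
      then obtain S0 where S0: "S0 \<subseteq> \<F>" "is_simplex r t S0" by blast
      have sub: "subspace F" if "F \<in> \<F>" for F using F that by (auto simp: k_subspaces_def)
      have "dim (\<Inter>\<F>) \<le> dim (\<Inter>S0)" using S0(1) by (intro dim_subset) blast
      then have dF: "dim (\<Inter>\<F>) < t" using S0(2) by (simp add: is_simplex_def)
      have "card S0 = r + 1" using S0(2) by (simp add: is_simplex_def)
      then have "S0 \<noteq> {}" by auto
      then obtain F1 where F1: "F1 \<in> \<F>" using S0(1) by blast
      have meet: "m \<le> dim (F \<inter> G)" if "F \<in> \<F>" "G \<in> \<F>" for F G
        unfolding m_def using that by (intro wise_intersecting_pairwise[OF wise r t sub dF])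
      have dFm: "dim (\<Inter>\<F>) < m" using dF m(3) by linarith
      obtain \<K> where \<K>: "\<K> \<subseteq> k_subspaces (m + 1)" "card \<K> \<le> q ^ (k * m + k)"
        "\<forall>F\<in>\<F>. \<exists>T\<in>\<K>. T \<subseteq> F"
        using kernels_exist[OF F F1 meet dFm] by blast
      obtain ker where ker: "\<And>F. F \<in> \<F> \<Longrightarrow> ker F \<in> \<K> \<and> ker F \<subseteq> F"
        using bchoice[OF \<K>(3)[unfolded Bex_def]] by blast
      have "\<not> generic m \<F> ker S" if "S \<subseteq> \<F>" "is_simplex r t S" for S
      proof
        assume gen: "generic m \<F> ker S"
        have "2 \<le> card S" "dim (\<Inter>S) < m" using that(2) r m(3) by (auto simp: is_simplex_def)
        note S = this
        have "\<exists>X\<in>k_subspaces (m + 2). \<F> \<subseteq> near_subspaces X k"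
          by (rule generic_simplex_near[OF F \<K>(1) ker meet that(1) S gen])
        then show False using False unfolding m(2) by blast
      qed
      then have "num_simplices r t \<F> \<le> card {S. S \<subseteq> \<F> \<and> card S = r + 1 \<and> \<not> generic m \<F> ker S}"
        unfolding num_simplices_def by (intro card_mono) (auto simp: is_simplex_def)
      also have "\<dots> \<le> 2 * (card \<K> * q ^ k * d) * card \<F> ^ r"
        unfolding d_def using r by (intro card_nongeneric_le[OF F \<K>(1) ker meet]) auto
      also have "\<dots> \<le> 2 * (q ^ (k * m + k) * q ^ k * d) * (q ^ (k * m + k) * c) ^ r"
      proof -
        have "card \<F> \<le> card \<K> * c" unfolding c_def using F \<K>(1) ker by (rule card_family_le)
        also have "\<dots> \<le> q ^ (k * m + k) * c" using \<K>(2) by (rule mult_right_mono) simp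
        finally have *: "card \<F> ^ r \<le> (q ^ (k * m + k) * c) ^ r" by (rule power_mono) simp
        have "2 * (card \<K> * q ^ k * d) \<le> 2 * (q ^ (k * m + k) * q ^ k * d)"
          by (intro mult_left_mono mult_right_mono \<K>(2)) simp_all
        then show ?thesis using * by (rule mult_mono) simp_all
      qed
      finally have upper: "num_simplices r t \<F> \<le>
        2 * (q ^ (k * m + k) * q ^ k * d) * (q ^ (k * m + k) * c) ^ r" .
      let ?e = "(k * m + k) * (r + 1) + k"
      define K where "K = q ^ (k * m + k)"
      have qe: "q ^ ?e = K ^ (r + 1) * q ^ k" unfolding K_def by (simp only: power_add power_mult)
      have "2 * 2 ^ (r + 1) * num_simplices r t \<F> \<le>
          2 * 2 ^ (r + 1) * (2 * (K * q ^ k * d) * (K * c) ^ r)"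
        unfolding K_def using upper by (rule mult_left_mono) simp
      also have "\<dots> = 2 ^ (r + 3) * q ^ ?e * d * c ^ r"
        unfolding qe by (simp add: power_mult_distrib power3_eq_cube power_add mult_ac)
      also have "\<dots> \<le> q ^ (r + 3) * q ^ ?e * d * c ^ r"
        using q_ge_2 by (intro mult_right_mono power_mono) auto
      also have "q ^ (r + 3) * q ^ ?e = q ^ (r + 3 + ?e)" by (rule power_add[symmetric])
      also have "q ^ (r + 3 + ?e) * d * c ^ r \<le> q ^ (n - k) * d * c ^ r"
        using exps(1) q_ge_2 unfolding m_def by (intro mult_right_mono power_increasing) auto
      also have "\<dots> \<le> c * c ^ r" using cd by (rule mult_right_mono) simp
      also have "\<dots> = c ^ (r + 1)" by simp
      also have "\<dots> \<le> 2 ^ (r + 1) * extremal_number r t k" by (rule extpos)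
      finally have "2 * num_simplices r t \<F> \<le> extremal_number r t k"
        by (simp add: mult.assoc mult.left_commute)
      moreover have "0 < extremal_number r t k"
      proof (rule ccontr)
        assume "\<not> 0 < extremal_number r t k"
        then have "c ^ (r + 1) \<le> 0" using extpos by simp
        then show False using cpos by simp
      qed
      ultimately show ?thesis by linarith
    qed
    moreover have "\<not> (\<exists>X\<in>k_subspaces (r + t). near_subspaces_star X k \<subseteq> \<F> \<and> \<F> \<subseteq> near_subspaces X k)"
      using False by blast
    ultimately show ?thesis by linarith
  qed
qed

end

theorem theorem1p1:
  fixes scale :: "'a::{field,finite} \<Rightarrow> 'v::ab_group_add \<Rightarrow> 'v"
    and B :: "'v set"
    and n k r t :: nat
    and \<F> :: "'v set set"
  assumes "finite_dimensional_vector_space scale B"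
    and "vector_space.dim scale (UNIV :: 'v set) = n"
    and "t \<ge> 1" and "r \<ge> 2" and "k \<ge> r + t - 1" and "n \<ge> 3 * k * r^2 + 3 * k * r * t"
    and "\<F> \<subseteq> vector_space.k_subspaces scale k"
    and "vector_space.wise_intersecting scale r t \<F>"
  shows "vector_space.num_simplices scale r t \<F> \<le> vector_space.extremal_number scale r t k \<and>
    (vector_space.num_simplices scale r t \<F> = vector_space.extremal_number scale r t k \<longleftrightarrow>
      (\<exists>X \<in> vector_space.k_subspaces scale (r + t).
         vector_space.near_subspaces_star scale X k \<subseteq> \<F> \<and>
         \<F> \<subseteq> vector_space.near_subspaces scale X k))"
proof -
  interpret V: finite_field_space scale B "card (UNIV :: 'a set)"
    using assms(1) by (intro finite_field_space.intro finite_field_space_axioms.intro) simp_all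
  show ?thesis using assms(2-8) by (rule V.simplex_count)
qed

end
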